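(* Let $C(\mathbb{R}_+,\mathbb{R})$, the space of continuous functions from $\mathbb{R}_+$ to $\mathbb{R}$, be endowed with the topology of uniform convergence on compact sets. Then $$\left(\frac{X_{\theta T}}{T^{3/4}}\right)_{\theta\ge 0} \;\xrightarrow[T\to 0]{}\; \left(\int_0^\theta u(s,0)\,\mathrm{d}s\right)_{\theta\ge 0}\quad\text{in law},$$ where $T>0$.
   Context: $B=(B(x))_{x\in\mathbb{R}}$ is a (two-sided, standard) Brownian motion on $\mathbb{R}$. $P_t(x)=\frac{e^{-x^2/(4t)}}{\sqrt{4\pi t}}$ is the heat kernel. The random potential $V$ is the solution of $V(0,x)=B(x)$, $\partial_t V=\partial_{xx}V$ for $t>0$, given by $V(t,x)=\int_{\mathbb{R}}P_t(x-y)B(y)\,\mathrm{d}y$ for $t>0$, $x\in\mathbb{R}$ (almost surely well defined and analytic). The velocity field is $u=-\partial_x V$, i.e. $u(t,x)=-\int_{\mathbb{R}}\partial_xP_t(x-y)B(y)\,\mathrm{d}y=-\int_{\mathbb{R}}P_t(x-y)\,\mathrm{d}B(y)$ for $t>0$, $x\in\mathbb{R}$. $X=(X_t)_{t\ge0}$ is the process, almost surely continuous on $\mathbb{R}_+$ and smooth on $\mathbb{R}_+^*=(0,\infty)$, satisfying almost surely $X_0=0$ and $\partial_tX_t=u(t,X_t)$ for all $t>0$. *)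

theory Defs
  imports "HOL-Probability.Probability"
begin

section \<open>Two-sided Brownian motion\<close>

text \<open>The argument order is \<open>B x \<omega>\<close>. Note that \<^const>\<open>normal_density\<close> takes the standard deviation.\<close>

definition brownian_motion :: "'a measure \<Rightarrow> (real \<Rightarrow> 'a \<Rightarrow> real) \<Rightarrow> bool" where
  "brownian_motion M B \<longleftrightarrow>
     prob_space M \<and>
     (\<forall>x. B x \<in> borel_measurable M) \<and>
     (AE \<omega> in M. B 0 \<omega> = 0) \<and>
     (\<forall>x y. x < y \<longrightarrow>
        distributed M lborel (\<lambda>\<omega>. B y \<omega> - B x \<omega>) (normal_density 0 (sqrt (y - x)))) \<and>
     (\<forall>n (x :: nat \<Rightarrow> real). strict_mono_on {..n} x \<longrightarrow>
        prob_space.indep_vars M (\<lambda>_. borel) (\<lambda>i \<omega>. B (x (Suc i)) \<omega> - B (x i) \<omega>) {..<n}) \<and>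
     (AE \<omega> in M. continuous_on UNIV (\<lambda>x. B x \<omega>))"


section \<open>Potential, velocity field and the driven process\<close>

definition heat_kernel :: "real \<Rightarrow> real \<Rightarrow> real" where
  "heat_kernel t x = exp (- x\<^sup>2 / (4 * t)) / sqrt (4 * pi * t)"

definition potential :: "(real \<Rightarrow> 'a \<Rightarrow> real) \<Rightarrow> real \<Rightarrow> real \<Rightarrow> 'a \<Rightarrow> real" where
  "potential B t x \<omega> =
     (if t = 0 then B x \<omega> else (\<integral>y. heat_kernel t (x - y) * B y \<omega> \<partial>lborel))"

text \<open>Only the values for \<open>t > 0\<close> are meaningful, since \<open>potential B 0\<close> is a Brownian path.\<close>

definition velocity :: "(real \<Rightarrow> 'a \<Rightarrow> real) \<Rightarrow> real \<Rightarrow> real \<Rightarrow> 'a \<Rightarrow> real" where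
  "velocity B t x \<omega> = - deriv (\<lambda>z. potential B t z \<omega>) x"

definition smooth_on_pos :: "(real \<Rightarrow> real) \<Rightarrow> bool" where
  "smooth_on_pos f \<longleftrightarrow> (\<forall>k. \<forall>t>0. (deriv ^^ k) f differentiable (at t))"

text \<open>The process has time index \<open>t \<ge> 0\<close>; values \<open>X t\<close> for \<open>t < 0\<close> are unconstrained.\<close>

definition driven_process :: "'a measure \<Rightarrow> (real \<Rightarrow> 'a \<Rightarrow> real) \<Rightarrow> (real \<Rightarrow> 'a \<Rightarrow> real) \<Rightarrow> bool" where
  "driven_process M B X \<longleftrightarrow>
     (\<forall>t\<ge>0. X t \<in> borel_measurable M) \<and>
     (AE \<omega> in M. continuous_on {0..} (\<lambda>t. X t \<omega>)) \<and>
     (AE \<omega> in M. smooth_on_pos (\<lambda>t. X t \<omega>)) \<and>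
     (AE \<omega> in M. X 0 \<omega> = 0) \<and>
     (AE \<omega> in M. \<forall>t>0. ((\<lambda>s. X s \<omega>) has_real_derivative velocity B t (X t \<omega>) \<omega>) (at t))"


section \<open>The space of continuous functions on the half-line\<close>

text \<open>Functions on \<open>{0..}\<close> are represented by total functions that are \<^const>\<open>undefined\<close> outside
  \<open>{0..}\<close>.\<close>

definition cont_fun_space :: "(real \<Rightarrow> real) set" where
  "cont_fun_space = {f \<in> extensional {0..}. continuous_on {0..} f}"

text \<open>Uniform convergence on compact sets: the sets of all \<open>g\<close> that are uniformly \<open>e\<close>-close to \<open>f\<close>
  on \<open>K\<close> form a base of neighbourhoods of \<open>f\<close>.\<close>

definition ucc_open :: "(real \<Rightarrow> real) set \<Rightarrow> bool" where
  "ucc_open U \<longleftrightarrow> U \<subseteq> cont_fun_space \<and>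
     (\<forall>f\<in>U. \<exists>K e. compact K \<and> K \<subseteq> {0..} \<and> e > 0 \<and>
        (\<forall>g\<in>cont_fun_space. (\<forall>t\<in>K. \<bar>g t - f t\<bar> < e) \<longrightarrow> g \<in> U))"

definition ucc_topology :: "(real \<Rightarrow> real) topology" where
  "ucc_topology = topology ucc_open"

lemma istopology_ucc_open: "istopology ucc_open"
proof -
  let ?near = "\<lambda>U f K e. compact K \<and> K \<subseteq> {0..} \<and> e > 0 \<and>
    (\<forall>g\<in>cont_fun_space. (\<forall>t\<in>K. \<bar>g t - f t\<bar> < e) \<longrightarrow> g \<in> U)"
  have near: "\<exists>K e. ?near U f K e" if "ucc_open U" "f \<in> U" for U f
    using that unfolding ucc_open_def by (elim conjE) (erule (1) bspec)
  have sub: "U \<subseteq> cont_fun_space" if "ucc_open U" for U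
    using that unfolding ucc_open_def by (rule conjunct1)
  have openI: "ucc_open U" if "U \<subseteq> cont_fun_space" "\<And>f. f \<in> U \<Longrightarrow> \<exists>K e. ?near U f K e" for U
    unfolding ucc_open_def using that by (intro conjI ballI)
  have "ucc_open (S \<inter> T)" if S: "ucc_open S" and T: "ucc_open T" for S T
  proof (rule openI)
    show "S \<inter> T \<subseteq> cont_fun_space" using sub[OF S] by (rule le_infI1)
    fix f assume f: "f \<in> S \<inter> T"
    obtain K e where K: "?near S f K e" using near[OF S IntD1[OF f]] by (elim exE)
    obtain L d where L: "?near T f L d" using near[OF T IntD2[OF f]] by (elim exE)
    have "?near (S \<inter> T) f (K \<union> L) (min e d)"
      using K L by (simp add: compact_Un)
    then show "\<exists>K e. ?near (S \<inter> T) f K e" by (intro exI)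
  qed
  moreover have "ucc_open (\<Union> \<K>)" if *: "\<forall>U\<in>\<K>. ucc_open U" for \<K>
  proof (rule openI)
    show "\<Union> \<K> \<subseteq> cont_fun_space" using sub * by (meson Sup_least)
    fix f assume "f \<in> \<Union> \<K>"
    then obtain U where U: "U \<in> \<K>" "f \<in> U" by (elim UnionE)
    obtain K e where K: "?near U f K e" using near[OF bspec[OF * U(1)] U(2)] by (elim exE)
    have "?near (\<Union> \<K>) f K e"
      using K UnionI[OF U(1)] by simp
    then show "\<exists>K e. ?near (\<Union> \<K>) f K e" by (intro exI)
  qed
  ultimately show ?thesis unfolding istopology_def by simp
qed

lemma openin_ucc_topology: "openin ucc_topology U \<longleftrightarrow> ucc_open U"
  unfolding ucc_topology_def using istopology_ucc_open by (simp add: topology_inverse')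

lemma topspace_ucc_topology: "topspace ucc_topology = cont_fun_space"
proof -
  have "ucc_open cont_fun_space"
    unfolding ucc_open_def
  proof (intro conjI ballI exI)
    show "compact ({} :: real set)" "(0::real) < 1" by simp_all
  qed auto
  then show ?thesis
    unfolding topspace_def openin_ucc_topology by (auto simp: ucc_open_def)
qed


section \<open>Convergence in law\<close>

definition borel_of :: "'b topology \<Rightarrow> 'b measure" where
  "borel_of T = sigma (topspace T) {U. openin T U}"

text \<open>A map may be a random element only up to a null set (such as a path that is continuous only
  almost surely), so its law is that of a measurable modification; it does not depend on the
  choice of the modification.\<close>

definition has_law :: "'a measure \<Rightarrow> 'b topology \<Rightarrow> ('a \<Rightarrow> 'b) \<Rightarrow> 'b measure \<Rightarrow> bool" where
  "has_law M T Y \<mu> \<longleftrightarrow>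
     (\<exists>Y' \<in> M \<rightarrow>\<^sub>M borel_of T. (AE \<omega> in M. Y \<omega> = Y' \<omega>) \<and> \<mu> = distr M (borel_of T) Y')"

definition weak_convergence ::
    "'b topology \<Rightarrow> ('i \<Rightarrow> 'b measure) \<Rightarrow> 'b measure \<Rightarrow> 'i filter \<Rightarrow> bool" where
  "weak_convergence T \<mu> \<nu> F \<longleftrightarrow>
     (\<forall>\<phi> :: 'b \<Rightarrow> real. continuous_map T euclideanreal \<phi> \<and> bounded (\<phi> ` topspace T) \<longrightarrow>
        ((\<lambda>i. \<integral>f. \<phi> f \<partial>\<mu> i) \<longlongrightarrow> (\<integral>f. \<phi> f \<partial>\<nu>)) F)"

definition converges_in_law ::
    "'a measure \<Rightarrow> 'b topology \<Rightarrow> ('i \<Rightarrow> 'a \<Rightarrow> 'b) \<Rightarrow> ('a \<Rightarrow> 'b) \<Rightarrow> 'i filter \<Rightarrow> bool" where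
  "converges_in_law M T Y Z F \<longleftrightarrow>
     (\<exists>\<mu> \<nu>. (\<forall>\<^sub>F i in F. has_law M T (Y i) (\<mu> i)) \<and> has_law M T Z \<nu> \<and>
        weak_convergence T \<mu> \<nu> F)"

end

theory Submission
  imports Defs
begin

text \<open>
  Brownian scaling turns the rescaled process \<open>Y \<theta> = X (\<theta> * T) / T powr (3/4)\<close> into a solution of
  \<open>Y' \<theta> = u\<^sub>T \<theta> (\<epsilon> * Y \<theta>)\<close> with \<open>\<epsilon> = T powr (1/4)\<close>, where \<open>u\<^sub>T\<close> is the velocity field of the Brownian
  motion \<open>B\<^sub>T x = B (sqrt T * x) / T powr (1/4)\<close>. If the weighted norm \<open>\<integral>B\<^sub>T\<^sup>2 / (1 + y\<^sup>2)\<^sup>2\<close> is at most \<open>R\<close>,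
  then \<open>u\<^sub>T s x\<close> is bounded by a multiple of \<open>s powr (- 3 / 4)\<close> near \<open>x = 0\<close>, which is integrable at
  \<open>s = 0\<close>, and is Lipschitz in \<open>x\<close> for \<open>s\<close> away from \<open>0\<close>; hence \<open>Y\<close> is uniformly close to the integral
  of \<open>u\<^sub>T s 0\<close> on compact intervals when \<open>T\<close> is small. The norm has an expectation that does not depend
  on \<open>T\<close>, so this happens with probability close to \<open>1\<close>. Finally the integral of \<open>u\<^sub>T s 0\<close> is a bounded
  linear functional of the path in the weighted norm, so it can be approximated by functions of
  finitely many increments, and these have the same law for \<open>B\<^sub>T\<close> and \<open>B\<close>.
\<close>

section \<open>The space of continuous functions on the half-line\<close>

lemma cont_fun_space_iff:
  "f \<in> cont_fun_space \<longleftrightarrow> f \<in> extensional {0..} \<and> continuous_on {0..} f"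
  by (simp add: cont_fun_space_def)

lemma restrict_in_cont_fun_space:
  "continuous_on {0..} f \<Longrightarrow> restrict f {0..} \<in> cont_fun_space"
  unfolding cont_fun_space_iff
  by (intro conjI restrict_extensional) (erule continuous_on_eq, simp)

lemma openin_subset_Pow: "{U. openin T U} \<subseteq> Pow (topspace T)"
  by (auto dest: openin_subset)

lemma space_borel_of [simp]: "space (borel_of T) = topspace T"
  unfolding borel_of_def by (rule space_measure_of[OF openin_subset_Pow])

lemma sets_borel_of: "sets (borel_of T) = sigma_sets (topspace T) {U. openin T U}"
  unfolding borel_of_def by (rule sets_measure_of[OF openin_subset_Pow])

lemma continuous_map_borel_measurable:
  assumes "continuous_map T euclideanreal \<phi>"
  shows "\<phi> \<in> borel_measurable (borel_of T)"
proof (rule borel_measurableI)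
  fix S :: "real set" assume "open S"
  then have "openin T {x \<in> topspace T. \<phi> x \<in> S}"
    using assms by (simp add: continuous_map_def)
  moreover have "\<phi> -` S \<inter> space (borel_of T) = {x \<in> topspace T. \<phi> x \<in> S}" by auto
  ultimately show "\<phi> -` S \<inter> space (borel_of T) \<in> sets (borel_of T)"
    by (simp add: sets_borel_of sigma_sets.Basic)
qed

lemma ucc_continuous_nhd:
  assumes "continuous_map ucc_topology euclideanreal \<phi>" "f \<in> cont_fun_space" "0 < \<eta>"
  obtains n :: nat and r where "0 < r"
    "\<And>g. g \<in> cont_fun_space \<Longrightarrow> \<forall>t\<in>{0..real n}. \<bar>f t - g t\<bar> \<le> r \<Longrightarrow> \<bar>\<phi> g - \<phi> f\<bar> < \<eta>"
proof -
  have "openin ucc_topology {x \<in> topspace ucc_topology. \<phi> x \<in> ball (\<phi> f) \<eta>}"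
    using assms(1) unfolding continuous_map_def by (metis open_ball open_openin)
  then have "ucc_open {x \<in> cont_fun_space. \<phi> x \<in> ball (\<phi> f) \<eta>}"
    by (simp add: openin_ucc_topology topspace_ucc_topology)
  then obtain K e where K: "compact K" "K \<subseteq> {0..}" "e > 0"
    "\<forall>g\<in>cont_fun_space. (\<forall>t\<in>K. \<bar>g t - f t\<bar> < e) \<longrightarrow> g \<in> {x \<in> cont_fun_space. \<phi> x \<in> ball (\<phi> f) \<eta>}"
    unfolding ucc_open_def using assms(2,3) by (metis (no_types, lifting) centre_in_ball mem_Collect_eq)
  obtain b where b: "\<And>x. x \<in> K \<Longrightarrow> norm x \<le> b"
    using compact_imp_bounded[OF K(1)] by (auto simp: bounded_iff)
  obtain n :: nat where n: "b \<le> real n" using real_arch_simple by blast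
  have Kn: "K \<subseteq> {0..real n}" using K(2) b n by force
  show ?thesis
  proof (rule that[of "e/2" n])
    show "0 < e/2" using K by simp
    fix g assume g: "g \<in> cont_fun_space" "\<forall>t\<in>{0..real n}. \<bar>f t - g t\<bar> \<le> e/2"
    have "\<forall>t\<in>K. \<bar>g t - f t\<bar> < e" using g(2) Kn K(3) by (smt (verit) field_sum_of_halves subset_eq)
    then have "\<phi> g \<in> ball (\<phi> f) \<eta>" using K(4) g(1) by blast
    then show "\<bar>\<phi> g - \<phi> f\<bar> < \<eta>" by (simp add: dist_real_def)
  qed
qed

definition ucc_lipschitz :: "nat \<Rightarrow> ((real \<Rightarrow> real) \<Rightarrow> real) \<Rightarrow> bool" where
  "ucc_lipschitz k \<psi> \<longleftrightarrow> (\<forall>f\<in>cont_fun_space. \<forall>g\<in>cont_fun_space. \<forall>r.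
     (\<forall>t\<in>{0..real k}. \<bar>f t - g t\<bar> \<le> r) \<longrightarrow> \<bar>\<psi> f - \<psi> g\<bar> \<le> real k * r)"

lemma ucc_lipschitz_continuous:
  assumes "ucc_lipschitz k \<psi>"
  shows "continuous_map ucc_topology euclideanreal \<psi>"
  unfolding continuous_map_def
proof (intro conjI allI impI)
  show "\<psi> \<in> topspace ucc_topology \<rightarrow> topspace euclideanreal" by simp
  fix S :: "real set" assume "openin euclideanreal S"
  then have S: "open S" by simp
  show "openin ucc_topology {x \<in> topspace ucc_topology. \<psi> x \<in> S}"
    unfolding openin_ucc_topology topspace_ucc_topology ucc_open_def
  proof (intro conjI ballI)
    fix f assume "f \<in> {x \<in> cont_fun_space. \<psi> x \<in> S}"
    then have f: "f \<in> cont_fun_space" "\<psi> f \<in> S" by auto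
    obtain e where e: "e > 0" "\<And>y. \<bar>y - \<psi> f\<bar> < e \<Longrightarrow> y \<in> S"
      using S f(2) unfolding open_dist dist_real_def by blast
    have *: "g \<in> {x \<in> cont_fun_space. \<psi> x \<in> S}"
      if g: "g \<in> cont_fun_space" and b: "\<forall>t\<in>{0..real k}. \<bar>g t - f t\<bar> < e / (real k + 1)" for g
    proof -
      have "\<bar>\<psi> g - \<psi> f\<bar> \<le> real k * (e / (real k + 1))"
        using assms g f b unfolding ucc_lipschitz_def by (meson less_imp_le)
      also have "\<dots> < e" using e(1) by (simp add: field_simps)
      finally show ?thesis using g e(2) by simp
    qed
    show "\<exists>K e. compact K \<and> K \<subseteq> {0..} \<and> 0 < e \<and>
      (\<forall>g\<in>cont_fun_space. (\<forall>t\<in>K. \<bar>g t - f t\<bar> < e) \<longrightarrow> g \<in> {x \<in> cont_fun_space. \<psi> x \<in> S})"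
      using * e(1) by (intro exI[of _ "{0..real k}"] exI[of _ "e / (real k + 1)"]) auto
  qed auto
qed

lemma floor_grid_tendsto: "(\<lambda>n. real_of_int \<lfloor>real n * t\<rfloor> / real n) \<longlonglongrightarrow> t"
proof (rule real_tendsto_sandwich)
  show "\<forall>\<^sub>F n in sequentially. t - 1 / real n \<le> real_of_int \<lfloor>real n * t\<rfloor> / real n"
    using eventually_gt_at_top[of 0]
  proof eventually_elim
    case (elim n)
    have "real n * t - 1 \<le> real_of_int \<lfloor>real n * t\<rfloor>" by linarith
    then have "(real n * t - 1) / real n \<le> real_of_int \<lfloor>real n * t\<rfloor> / real n"
      by (rule divide_right_mono) simp
    then show ?case using elim by (simp add: diff_divide_distrib)
  qed
  show "\<forall>\<^sub>F n in sequentially. real_of_int \<lfloor>real n * t\<rfloor> / real n \<le> t"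
    using eventually_gt_at_top[of 0]
  proof eventually_elim
    case (elim n)
    have "real_of_int \<lfloor>real n * t\<rfloor> \<le> real n * t" by linarith
    then show ?case using elim by (simp add: field_simps)
  qed
  show "(\<lambda>n. t - 1 / real n) \<longlonglongrightarrow> t"
    using tendsto_diff[OF tendsto_const[of t] lim_1_over_n[where 'a=real]] by simp
qed simp

definition rat_bernstein :: "nat \<Rightarrow> rat list \<Rightarrow> real \<Rightarrow> real" where
  "rat_bernstein N cs t =
     (\<Sum>k\<le>length cs. (if k < length cs then of_rat (cs ! k) else 0) * Bernstein (length cs - 1) k (t / real N))"

lemma continuous_rat_bernstein: "continuous_on A (rat_bernstein N cs)"
  unfolding rat_bernstein_def Bernstein_def by (cases "N = 0") (auto intro!: continuous_intros)

lemma rat_bernstein_dense: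
  assumes f: "continuous_on {0..} f" and N: "0 < N" and e: "0 < e"
  shows "\<exists>cs. \<forall>t\<in>{0..real N}. \<bar>f t - rat_bernstein N cs t\<bar> < e"
proof -
  have "continuous_on {0..1} (\<lambda>x. f (real N * x))"
    by (rule continuous_on_compose2[OF f]) (auto intro!: continuous_intros)
  from Bernstein_Weierstrass[OF this, of "e/2"] e obtain n where
    n: "\<And>x. x \<in> {0..1} \<Longrightarrow> \<bar>f (real N * x) - (\<Sum>k\<le>n. f (real N * (k/n)) * Bernstein n k x)\<bar> < e/2"
    by (meson half_gt_zero le_refl)
  have "\<exists>q::rat. \<bar>of_rat q - f (real N * (real k/n))\<bar> < e/2" for k
  proof -
    obtain r where "r \<in> \<rat>" "f (real N * (real k/n)) - e/2 < r" "r < f (real N * (real k/n)) + e/2"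
      using Rats_dense_in_real[of "f (real N * (real k/n)) - e/2" "f (real N * (real k/n)) + e/2"] e by auto
    moreover obtain q where "r = of_rat q" using \<open>r \<in> \<rat>\<close> by (auto elim: Rats_cases)
    ultimately show ?thesis by (intro exI[of _ q]) (simp only: abs_less_iff, linarith)
  qed
  then obtain q :: "nat \<Rightarrow> rat" where q: "\<And>k. \<bar>of_rat (q k) - f (real N * (real k/n))\<bar> < e/2" by metis
  define cs where "cs = map q [0..<Suc n]"
  have len: "length cs = Suc n" by (simp add: cs_def)
  have nth: "k \<le> n \<Longrightarrow> cs ! k = q k" for k by (simp add: cs_def nth_map_upt del: upt_Suc)
  have rb: "rat_bernstein N cs t = (\<Sum>k\<le>n. of_rat (q k) * Bernstein n k (t / real N))" for t
    unfolding rat_bernstein_def len by (simp add: nth)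
  show ?thesis
  proof (intro exI[of _ cs] ballI)
    fix t assume t: "t \<in> {0..real N}"
    define x where "x = t / real N"
    have x: "x \<in> {0..1}" "t = real N * x" using t N by (auto simp: x_def field_simps)
    have "\<bar>(\<Sum>k\<le>n. f (real N * (k/n)) * Bernstein n k x) - (\<Sum>k\<le>n. of_rat (q k) * Bernstein n k x)\<bar>
        = \<bar>\<Sum>k\<le>n. (f (real N * (k/n)) - of_rat (q k)) * Bernstein n k x\<bar>"
      by (simp add: sum_subtractf left_diff_distrib)
    also have "\<dots> \<le> (\<Sum>k\<le>n. e/2 * Bernstein n k x)"
    proof (rule order_trans[OF sum_abs], rule sum_mono)
      fix k assume "k \<in> {..n}"
      have "\<bar>f (real N * (k/n)) - of_rat (q k)\<bar> \<le> e/2" using q[of k] by linarith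
      then show "\<bar>(f (real N * (k/n)) - of_rat (q k)) * Bernstein n k x\<bar> \<le> e/2 * Bernstein n k x"
        using x(1) Bernstein_nonneg[of x n k] by (simp only: abs_mult abs_of_nonneg mult_right_mono atLeastAtMost_iff)
    qed
    also have "\<dots> = e/2" by (simp only: sum_distrib_left[symmetric] sum_Bernstein mult_1_right)
    finally show "\<bar>f t - rat_bernstein N cs t\<bar> < e"
      unfolding rb x_def[symmetric] using n[OF x(1)] unfolding x(2) by linarith
  qed
qed

lemma measurable_borel_of_uccI:
  assumes Y: "\<And>\<omega>. \<omega> \<in> space M \<Longrightarrow> Y \<omega> \<in> cont_fun_space"
    and meas: "\<And>t. 0 \<le> t \<Longrightarrow> (\<lambda>\<omega>. Y \<omega> t) \<in> borel_measurable M"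
  shows "Y \<in> M \<rightarrow>\<^sub>M borel_of ucc_topology"
  unfolding borel_of_def
proof (rule measurable_measure_of[OF openin_subset_Pow])
  show "Y \<in> space M \<rightarrow> topspace ucc_topology" using Y by (auto simp: topspace_ucc_topology)
  fix U assume "U \<in> {U. openin ucc_topology U}"
  then have U: "ucc_open U" by (simp add: openin_ucc_topology)
  define D where "D N cs m = {g \<in> cont_fun_space. \<forall>t\<in>\<rat> \<inter> {0..real N}. \<bar>g t - rat_bernstein N cs t\<bar> \<le> 1 / real (Suc m)}"
    for N m :: nat and cs
  define I where "I = {(N, cs, m). D N cs m \<subseteq> U}"
  have D_close: "\<bar>g t - rat_bernstein N cs t\<bar> \<le> 1 / real (Suc m)"
    if g: "g \<in> D N cs m" and t: "t \<in> {0..real N}" for g N cs m t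
  proof -
    let ?t = "\<lambda>n. real_of_int \<lfloor>real n * t\<rfloor> / real n"
    have t0: "?t n \<in> {0..}" for n using t by auto
    have tn: "?t n \<le> t" for n
    proof (cases "n = 0")
      case False
      have "real_of_int \<lfloor>real n * t\<rfloor> \<le> real n * t" by linarith
      then show ?thesis using False by (simp add: field_simps)
    qed (use t in simp)
    have g': "continuous_on {0..} g" using g by (auto simp: D_def cont_fun_space_iff)
    have "(\<lambda>n. \<bar>g (?t n) - rat_bernstein N cs (?t n)\<bar>) \<longlonglongrightarrow> \<bar>g t - rat_bernstein N cs t\<bar>"
      using t0 t by (intro tendsto_intros continuous_on_tendsto_compose[OF g']
          continuous_on_tendsto_compose[OF continuous_rat_bernstein[of UNIV]] floor_grid_tendsto) auto
    moreover have "\<bar>g (?t n) - rat_bernstein N cs (?t n)\<bar> \<le> 1 / real (Suc m)" for n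
    proof -
      have "?t n \<in> \<rat>" by simp
      moreover have "?t n \<in> {0..real N}" using t0[of n] tn[of n] t by auto
      ultimately show ?thesis using g unfolding D_def by blast
    qed
    ultimately show ?thesis by (meson LIMSEQ_le_const2)
  qed
  have "U = (\<Union>(N, cs, m)\<in>I. D N cs m)"
  proof
    show "(\<Union>(N, cs, m)\<in>I. D N cs m) \<subseteq> U" by (auto simp: I_def)
    show "U \<subseteq> (\<Union>(N, cs, m)\<in>I. D N cs m)"
    proof
      fix f assume f: "f \<in> U"
      obtain K e where K: "compact K" "K \<subseteq> {0..}" "e > 0"
        "\<forall>g\<in>cont_fun_space. (\<forall>t\<in>K. \<bar>g t - f t\<bar> < e) \<longrightarrow> g \<in> U"
        using U f unfolding ucc_open_def by blast
      have fC: "f \<in> cont_fun_space" using U f unfolding ucc_open_def by blast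
      obtain b where b: "\<And>x. x \<in> K \<Longrightarrow> norm x \<le> b"
        using compact_imp_bounded[OF K(1)] by (auto simp: bounded_iff)
      obtain N0 :: nat where N0: "b \<le> real N0" using real_arch_simple by blast
      define N where "N = Suc N0"
      have KN: "K \<subseteq> {0..real N}" using K(2) b N0 by (force simp: N_def)
      obtain m where m: "1 / real (Suc m) < e/2"
        using K(3) nat_approx_posE[of "e/2"] by (metis half_gt_zero)
      obtain cs where cs: "\<forall>t\<in>{0..real N}. \<bar>f t - rat_bernstein N cs t\<bar> < 1 / real (Suc m)"
        using rat_bernstein_dense[of f N "1 / real (Suc m)"] fC by (auto simp: N_def cont_fun_space_iff)
      have "f \<in> D N cs m" using cs fC by (auto simp: D_def intro!: less_imp_le)
      moreover have "D N cs m \<subseteq> U"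
      proof
        fix g assume g: "g \<in> D N cs m"
        have "\<forall>t\<in>K. \<bar>g t - f t\<bar> < e"
        proof
          fix t assume "t \<in> K"
          then have t: "t \<in> {0..real N}" using KN by auto
          show "\<bar>g t - f t\<bar> < e" using D_close[OF g t] cs[rule_format, OF t] m by linarith
        qed
        then show "g \<in> U" using K(4) g by (auto simp: D_def)
      qed
      ultimately show "f \<in> (\<Union>(N, cs, m)\<in>I. D N cs m)" by (auto simp: I_def)
    qed
  qed
  then have "Y -` U \<inter> space M = (\<Union>(N, cs, m)\<in>I. {\<omega>\<in>space M. \<forall>t\<in>\<rat> \<inter> {0..real N}. \<bar>Y \<omega> t - rat_bernstein N cs t\<bar> \<le> 1 / real (Suc m)})"
    using Y by (fastforce simp: D_def)
  moreover have "{\<omega>\<in>space M. \<forall>t\<in>\<rat> \<inter> {0..real N}. \<bar>Y \<omega> t - rat_bernstein N cs t\<bar> \<le> 1 / real (Suc m)} \<in> sets M" for N cs m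
  proof (rule sets.sets_Collect_countable_All')
    show "countable (\<rat> \<inter> {0..real N})" using countable_rat by (rule countable_subset[rotated]) auto
    fix t assume "t \<in> \<rat> \<inter> {0..real N}"
    then have [measurable]: "(\<lambda>\<omega>. Y \<omega> t) \<in> borel_measurable M" by (intro meas) auto
    show "{\<omega>\<in>space M. \<bar>Y \<omega> t - rat_bernstein N cs t\<bar> \<le> 1 / real (Suc m)} \<in> sets M" by measurable
  qed
  ultimately show "Y -` U \<inter> space M \<in> sets M"
    by (auto intro!: sets.countable_UN')
qed

text \<open>The infimum runs over pairs of a function and a radius, so that no supremum over
  \<open>{0..real k}\<close> has to be handled. These Lipschitz minorants increase to \<open>\<phi>\<close>, so
  convergence of expectations of Lipschitz functions suffices, without any tightness argument.\<close>

definition lip_approx :: "((real \<Rightarrow> real) \<Rightarrow> real) \<Rightarrow> nat \<Rightarrow> (real \<Rightarrow> real) \<Rightarrow> real" where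
  "lip_approx \<phi> k f = Inf {\<phi> g + real k * r | g r. g \<in> cont_fun_space \<and> 0 \<le> r \<and> (\<forall>t\<in>{0..real k}. \<bar>f t - g t\<bar> \<le> r)}"

context
  fixes \<phi> :: "(real \<Rightarrow> real) \<Rightarrow> real" and b
  assumes bounded_phi: "\<And>f. f \<in> cont_fun_space \<Longrightarrow> \<bar>\<phi> f\<bar> \<le> b"
begin

lemma lip_approx_lower:
  assumes "\<And>g r. g \<in> cont_fun_space \<Longrightarrow> 0 \<le> r \<Longrightarrow> \<forall>t\<in>{0..real k}. \<bar>f t - g t\<bar> \<le> r \<Longrightarrow> c \<le> \<phi> g + real k * r"
    and "f \<in> cont_fun_space"
  shows "c \<le> lip_approx \<phi> k f"
  unfolding lip_approx_def
proof (rule cInf_greatest)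
  show "{\<phi> g + real k * r | g r. g \<in> cont_fun_space \<and> 0 \<le> r \<and> (\<forall>t\<in>{0..real k}. \<bar>f t - g t\<bar> \<le> r)} \<noteq> {}"
    using assms(2) by (auto intro!: exI[of _ f] exI[of _ 0])
qed (use assms(1) in blast)

lemma lip_approx_upper:
  assumes "g \<in> cont_fun_space" "0 \<le> r" "\<forall>t\<in>{0..real k}. \<bar>f t - g t\<bar> \<le> r"
  shows "lip_approx \<phi> k f \<le> \<phi> g + real k * r"
  unfolding lip_approx_def
proof (rule cInf_lower)
  have "- b \<le> \<phi> g + real k * r" if "g \<in> cont_fun_space" "0 \<le> r" for g r
    using bounded_phi[OF that(1)] that(2) by (smt (verit) mult_nonneg_nonneg of_nat_0_le_iff)
  then show "bdd_below {\<phi> g + real k * r | g r. g \<in> cont_fun_space \<and> 0 \<le> r \<and> (\<forall>t\<in>{0..real k}. \<bar>f t - g t\<bar> \<le> r)}"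
    by (auto simp: bdd_below_def)
qed (use assms in blast)

lemma lip_approx_le: "f \<in> cont_fun_space \<Longrightarrow> lip_approx \<phi> k f \<le> \<phi> f"
  using lip_approx_upper[of f 0 k f] by simp

lemma lip_approx_bounded:
  assumes f: "f \<in> cont_fun_space" shows "\<bar>lip_approx \<phi> k f\<bar> \<le> b"
proof -
  have "- b \<le> lip_approx \<phi> k f"
  proof (rule lip_approx_lower[OF _ f])
    fix g and r :: real assume "g \<in> cont_fun_space" "0 \<le> r"
    then show "- b \<le> \<phi> g + real k * r"
      using bounded_phi[of g] by (smt (verit) mult_nonneg_nonneg of_nat_0_le_iff)
  qed
  then show ?thesis using lip_approx_le[OF f, of k] bounded_phi[OF f] by linarith
qed

lemma lip_approx_lipschitz: "ucc_lipschitz k (lip_approx \<phi> k)"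
proof -
  have *: "lip_approx \<phi> k f - real k * r \<le> lip_approx \<phi> k g"
    if f: "f \<in> cont_fun_space" and g: "g \<in> cont_fun_space" and r: "\<forall>t\<in>{0..real k}. \<bar>f t - g t\<bar> \<le> r" for f g r
  proof (rule lip_approx_lower[OF _ g])
    fix h and r' :: real assume h: "h \<in> cont_fun_space" "0 \<le> r'" "\<forall>t\<in>{0..real k}. \<bar>g t - h t\<bar> \<le> r'"
    have "0 \<le> r" using r[rule_format, of 0] by simp
    have "lip_approx \<phi> k f \<le> \<phi> h + real k * (r + r')"
      using h r \<open>0 \<le> r\<close> by (intro lip_approx_upper) (auto, smt (verit) atLeastAtMost_iff)
    then show "lip_approx \<phi> k f - real k * r \<le> \<phi> h + real k * r'" by (simp add: algebra_simps)
  qed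
  show ?thesis unfolding ucc_lipschitz_def
  proof (intro ballI allI impI)
    fix f g r assume "f \<in> cont_fun_space" "g \<in> cont_fun_space" "\<forall>t\<in>{0..real k}. \<bar>f t - g t\<bar> \<le> r"
    then show "\<bar>lip_approx \<phi> k f - lip_approx \<phi> k g\<bar> \<le> real k * r"
      using *[of f g r] *[of g f r] by (simp add: abs_minus_commute)
  qed
qed

lemma lip_approx_tendsto:
  assumes cont: "continuous_map ucc_topology euclideanreal \<phi>" and f: "f \<in> cont_fun_space"
  shows "(\<lambda>k. lip_approx \<phi> k f) \<longlonglongrightarrow> \<phi> f"
proof (rule LIMSEQ_I)
  fix \<eta> :: real assume "0 < \<eta>"
  obtain n :: nat and r where r: "0 < r"
    "\<And>g. g \<in> cont_fun_space \<Longrightarrow> \<forall>t\<in>{0..real n}. \<bar>f t - g t\<bar> \<le> r \<Longrightarrow> \<bar>\<phi> g - \<phi> f\<bar> < \<eta>/2"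
    using ucc_continuous_nhd[OF cont f, of "\<eta>/2"] \<open>0 < \<eta>\<close> by (metis half_gt_zero)
  obtain m :: nat where m: "2 * b / r \<le> real m" using real_arch_simple by blast
  show "\<exists>no. \<forall>k\<ge>no. norm (lip_approx \<phi> k f - \<phi> f) < \<eta>"
  proof (intro exI[of _ "max n m"] allI impI)
    fix k assume k: "max n m \<le> k"
    have "\<phi> f - \<eta>/2 \<le> lip_approx \<phi> k f"
    proof (rule lip_approx_lower[OF _ f])
      fix g r' assume g: "g \<in> cont_fun_space" "0 \<le> r'" "\<forall>t\<in>{0..real k}. \<bar>f t - g t\<bar> \<le> r'"
      show "\<phi> f - \<eta>/2 \<le> \<phi> g + real k * r'"
      proof (cases "r' \<le> r")
        case True
        have "\<bar>\<phi> g - \<phi> f\<bar> < \<eta>/2" by (rule r(2)[OF g(1)]) (use g(3) True k in force)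
        moreover have "0 \<le> real k * r'" using g(2) by simp
        ultimately show ?thesis by linarith
      next
        case False
        have "2 * b \<le> real m * r" using m r(1) by (simp add: field_simps)
        also have "\<dots> \<le> real k * r'" using False k r(1) by (intro mult_mono) auto
        finally show ?thesis using bounded_phi[OF f] bounded_phi[OF g(1)] \<open>0 < \<eta>\<close> by linarith
      qed
    qed
    then show "norm (lip_approx \<phi> k f - \<phi> f) < \<eta>"
      using lip_approx_le[OF f, of k] \<open>0 < \<eta>\<close> by simp
  qed
qed

end

lemma (in prob_space) expectation_lip_lower:
  fixes Y :: "'i \<Rightarrow> 'a \<Rightarrow> real \<Rightarrow> real"
  assumes Y: "\<forall>\<^sub>F i in F. Y i \<in> M \<rightarrow>\<^sub>M borel_of ucc_topology" and Z: "Z \<in> M \<rightarrow>\<^sub>M borel_of ucc_topology"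
    and lim: "\<And>k \<psi> b. ucc_lipschitz k \<psi> \<Longrightarrow> (\<And>f. f \<in> cont_fun_space \<Longrightarrow> \<bar>\<psi> f\<bar> \<le> b) \<Longrightarrow>
        ((\<lambda>i. expectation (\<lambda>\<omega>. \<psi> (Y i \<omega>))) \<longlongrightarrow> expectation (\<lambda>\<omega>. \<psi> (Z \<omega>))) F"
    and cont: "continuous_map ucc_topology euclideanreal \<phi>"
    and bd: "\<And>f. f \<in> cont_fun_space \<Longrightarrow> \<bar>\<phi> f\<bar> \<le> b" and e: "0 < e"
  shows "\<forall>\<^sub>F i in F. expectation (\<lambda>\<omega>. \<phi> (Z \<omega>)) - e < expectation (\<lambda>\<omega>. \<phi> (Y i \<omega>))"
proof -
  have meas: "(\<lambda>\<omega>. \<psi> (V \<omega>)) \<in> borel_measurable M"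
    if "continuous_map ucc_topology euclideanreal \<psi>" "V \<in> M \<rightarrow>\<^sub>M borel_of ucc_topology" for \<psi> V
    by (rule measurable_compose[OF that(2) continuous_map_borel_measurable[OF that(1)]])
  have sp: "V \<omega> \<in> cont_fun_space" if "V \<in> M \<rightarrow>\<^sub>M borel_of ucc_topology" "\<omega> \<in> space M" for V \<omega>
    using measurable_space[OF that] by (simp add: topspace_ucc_topology)
  have lip: "ucc_lipschitz k (lip_approx \<phi> k)" for k
    using lip_approx_lipschitz[of \<phi> b k] bd by blast
  have lb: "\<bar>lip_approx \<phi> k f\<bar> \<le> b" if "f \<in> cont_fun_space" for k f
    using lip_approx_bounded[of \<phi> b f k] bd that by blast
  have le: "lip_approx \<phi> k f \<le> \<phi> f" if "f \<in> cont_fun_space" for k f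
    using lip_approx_le[of \<phi> b f k] bd that by blast
  have tend: "(\<lambda>k. lip_approx \<phi> k f) \<longlonglongrightarrow> \<phi> f" if "f \<in> cont_fun_space" for f
    using lip_approx_tendsto[of \<phi> b f] bd cont that by blast
  have m1: "(\<lambda>\<omega>. lip_approx \<phi> k (V \<omega>)) \<in> borel_measurable M"
    if "V \<in> M \<rightarrow>\<^sub>M borel_of ucc_topology" for V k
    by (rule meas[OF ucc_lipschitz_continuous[OF lip] that])
  have "(\<lambda>k. expectation (\<lambda>\<omega>. lip_approx \<phi> k (Z \<omega>))) \<longlonglongrightarrow> expectation (\<lambda>\<omega>. \<phi> (Z \<omega>))"
  proof (rule integral_dominated_convergence[where w="\<lambda>_. b"])
    show "AE \<omega> in M. (\<lambda>k. lip_approx \<phi> k (Z \<omega>)) \<longlonglongrightarrow> \<phi> (Z \<omega>)"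
      by (rule AE_I2) (rule tend[OF sp[OF Z]])
    show "AE \<omega> in M. norm (lip_approx \<phi> k (Z \<omega>)) \<le> b" for k
      by (rule AE_I2) (use lb[OF sp[OF Z]] in simp)
  qed (use meas[OF cont Z] m1[OF Z] in auto)
  then have "\<forall>\<^sub>F k in sequentially. expectation (\<lambda>\<omega>. \<phi> (Z \<omega>)) - e < expectation (\<lambda>\<omega>. lip_approx \<phi> k (Z \<omega>))"
    by (rule order_tendstoD) (use e in simp)
  then obtain k where k: "expectation (\<lambda>\<omega>. \<phi> (Z \<omega>)) - e < expectation (\<lambda>\<omega>. lip_approx \<phi> k (Z \<omega>))"
    by (meson eventually_happens trivial_limit_sequentially)
  have "\<forall>\<^sub>F i in F. expectation (\<lambda>\<omega>. \<phi> (Z \<omega>)) - e < expectation (\<lambda>\<omega>. lip_approx \<phi> k (Y i \<omega>))"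
    using lim[of k "lip_approx \<phi> k" b, OF lip lb] k by (rule order_tendstoD)
  then show ?thesis using Y
  proof eventually_elim
    case (elim i)
    have "expectation (\<lambda>\<omega>. lip_approx \<phi> k (Y i \<omega>)) \<le> expectation (\<lambda>\<omega>. \<phi> (Y i \<omega>))"
    proof (rule integral_mono)
      show "integrable M (\<lambda>\<omega>. lip_approx \<phi> k (Y i \<omega>))"
        by (rule integrable_const_bound[where B=b]) (use lb[OF sp[OF elim(2)]] m1[OF elim(2)] in auto)
      show "integrable M (\<lambda>\<omega>. \<phi> (Y i \<omega>))"
        by (rule integrable_const_bound[where B=b]) (use bd[OF sp[OF elim(2)]] meas[OF cont elim(2)] in auto)
    qed (rule le[OF sp[OF elim(2)]])
    with elim show ?case by linarith
  qed
qed

lemma (in prob_space) weak_convergence_uccI: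
  fixes Y :: "'i \<Rightarrow> 'a \<Rightarrow> real \<Rightarrow> real"
  assumes Y: "\<forall>\<^sub>F i in F. Y i \<in> M \<rightarrow>\<^sub>M borel_of ucc_topology" and Z: "Z \<in> M \<rightarrow>\<^sub>M borel_of ucc_topology"
    and lim: "\<And>k \<psi> b. ucc_lipschitz k \<psi> \<Longrightarrow> (\<And>f. f \<in> cont_fun_space \<Longrightarrow> \<bar>\<psi> f\<bar> \<le> b) \<Longrightarrow>
        ((\<lambda>i. expectation (\<lambda>\<omega>. \<psi> (Y i \<omega>))) \<longlongrightarrow> expectation (\<lambda>\<omega>. \<psi> (Z \<omega>))) F"
  shows "weak_convergence ucc_topology (\<lambda>i. distr M (borel_of ucc_topology) (Y i))
           (distr M (borel_of ucc_topology) Z) F"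
  unfolding weak_convergence_def
proof (intro allI impI, elim conjE)
  fix \<phi> :: "(real \<Rightarrow> real) \<Rightarrow> real"
  assume cont: "continuous_map ucc_topology euclideanreal \<phi>" and "bounded (\<phi> ` topspace ucc_topology)"
  then obtain b where bd: "\<And>f. f \<in> cont_fun_space \<Longrightarrow> \<bar>\<phi> f\<bar> \<le> b"
    by (auto simp: bounded_iff topspace_ucc_topology)
  have cont': "continuous_map ucc_topology euclideanreal (\<lambda>f. - \<phi> f)"
    using cont by (rule continuous_map_minus)
  have "((\<lambda>i. expectation (\<lambda>\<omega>. \<phi> (Y i \<omega>))) \<longlongrightarrow> expectation (\<lambda>\<omega>. \<phi> (Z \<omega>))) F"
  proof (rule tendstoI)
    fix e :: real assume e: "0 < e"
    have bd': "\<bar>- \<phi> f\<bar> \<le> b" if "f \<in> cont_fun_space" for f using bd[OF that] by simp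
    have 1: "\<forall>\<^sub>F i in F. expectation (\<lambda>\<omega>. \<phi> (Z \<omega>)) - e < expectation (\<lambda>\<omega>. \<phi> (Y i \<omega>))"
      by (rule expectation_lip_lower[OF Y Z lim cont bd e])
    have 2: "\<forall>\<^sub>F i in F. expectation (\<lambda>\<omega>. - \<phi> (Z \<omega>)) - e < expectation (\<lambda>\<omega>. - \<phi> (Y i \<omega>))"
      by (rule expectation_lip_lower[OF Y Z lim cont' bd' e])
    show "\<forall>\<^sub>F i in F. dist (expectation (\<lambda>\<omega>. \<phi> (Y i \<omega>))) (expectation (\<lambda>\<omega>. \<phi> (Z \<omega>))) < e"
      using 1 2 by eventually_elim (simp add: dist_real_def abs_less_iff)
  qed
  moreover have "\<forall>\<^sub>F i in F. expectation (\<lambda>\<omega>. \<phi> (Y i \<omega>)) = (\<integral>f. \<phi> f \<partial>distr M (borel_of ucc_topology) (Y i))"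
    using Y by eventually_elim (simp add: integral_distr continuous_map_borel_measurable[OF cont])
  moreover have "expectation (\<lambda>\<omega>. \<phi> (Z \<omega>)) = (\<integral>f. \<phi> f \<partial>distr M (borel_of ucc_topology) Z)"
    by (simp add: integral_distr Z continuous_map_borel_measurable[OF cont])
  ultimately show "((\<lambda>i. \<integral>f. \<phi> f \<partial>distr M (borel_of ucc_topology) (Y i)) \<longlongrightarrow>
      (\<integral>f. \<phi> f \<partial>distr M (borel_of ucc_topology) Z)) F"
    by (simp add: filterlim_cong)
qed

section \<open>Estimates for the heat kernel\<close>

definition weight :: "real \<Rightarrow> real" where "weight y = 1 + y\<^sup>2"

definition heat_kernel' :: "real \<Rightarrow> real \<Rightarrow> real" where
  "heat_kernel' t x = - x / (2 * t) * heat_kernel t x"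

definition heat_kernel'' :: "real \<Rightarrow> real \<Rightarrow> real" where
  "heat_kernel'' t x = (x\<^sup>2 / (4 * t\<^sup>2) - 1 / (2 * t)) * heat_kernel t x"

definition heat_conv' :: "(real \<Rightarrow> real) \<Rightarrow> real \<Rightarrow> real \<Rightarrow> real" where
  "heat_conv' f t x = (\<integral>y. heat_kernel' t (x - y) * f y \<partial>lborel)"

definition tame :: "(real \<Rightarrow> real) \<Rightarrow> bool" where
  "tame f \<longleftrightarrow> f \<in> borel_measurable borel \<and> integrable lborel (\<lambda>y. (f y)\<^sup>2 / (weight y)\<^sup>2)"

definition wnorm2 :: "(real \<Rightarrow> real) \<Rightarrow> real" where
  "wnorm2 f = (\<integral>y. (f y)\<^sup>2 / (weight y)\<^sup>2 \<partial>lborel)"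

lemma weight_ge_1: "1 \<le> weight y" by (simp add: weight_def)
lemma weight_pos [simp]: "0 < weight y" using weight_ge_1[of y] by linarith
lemma weight_nonneg [simp]: "0 \<le> weight y" using weight_pos[of y] by linarith
lemma weight_nonzero [simp]: "weight y \<noteq> 0" using weight_pos[of y] by linarith
lemma weight_measurable [measurable]: "weight \<in> borel_measurable borel"
  unfolding weight_def by measurable

lemma weight_shift: "weight y \<le> 2 * weight x * weight (x - y)"
proof -
  have "y\<^sup>2 \<le> 2 * x\<^sup>2 + 2 * (x - y)\<^sup>2"
    using sum_squares_ge_zero[of "2 * x - y" 0] by (simp add: power2_eq_square algebra_simps)
  moreover have "0 \<le> x\<^sup>2 * (x - y)\<^sup>2" "0 \<le> x\<^sup>2" "0 \<le> (x - y)\<^sup>2" by simp_all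
  ultimately show ?thesis unfolding weight_def distrib_left distrib_right by linarith
qed

lemma weight_near:
  assumes "\<bar>x - y\<bar> \<le> 1" shows "weight y \<le> 3 * weight x"
proof -
  have "(x - y)\<^sup>2 \<le> 1" using assms by (simp add: abs_square_le_1)
  moreover have "y\<^sup>2 \<le> 2 * x\<^sup>2 + 2 * (x - y)\<^sup>2"
    using sum_squares_ge_zero[of "2 * x - y" 0] by (simp add: power2_eq_square algebra_simps)
  ultimately have "y\<^sup>2 \<le> 2 * x\<^sup>2 + 2 * 1" by (smt (verit))
  moreover have "0 \<le> x\<^sup>2" by simp
  ultimately show ?thesis unfolding weight_def by (smt (verit))
qed

lemma heat_kernel_measurable [measurable (raw)]:
  assumes [measurable]: "f \<in> borel_measurable M" "g \<in> borel_measurable M"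
  shows "(\<lambda>x. heat_kernel (f x) (g x)) \<in> borel_measurable M"
  unfolding heat_kernel_def by measurable

lemma heat_kernel'_measurable [measurable (raw)]:
  assumes [measurable]: "f \<in> borel_measurable M" "g \<in> borel_measurable M"
  shows "(\<lambda>x. heat_kernel' (f x) (g x)) \<in> borel_measurable M"
  unfolding heat_kernel'_def by measurable

lemma integrable_inverse_weight: "integrable lborel (\<lambda>y. 1 / weight y)"
  using integrable_inverse_1_plus_square
  by (simp add: set_integrable_def weight_def inverse_eq_divide)

lemma integrable_bound_weight:
  assumes [measurable]: "f \<in> borel_measurable borel" and "\<And>y. \<bar>f y\<bar> \<le> C / weight y"
  shows "integrable lborel f"
  by (rule Bochner_Integration.integrable_bound[OF integrable_mult_right[OF integrable_inverse_weight, of C]])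
     (auto intro!: AE_I2 order_trans[OF assms(2)] divide_right_mono)

lemma integrable_inverse_weight2: "integrable lborel (\<lambda>y. 1 / (weight y)\<^sup>2)"
proof (rule integrable_bound_weight[where C=1])
  show "\<bar>1 / (weight y)\<^sup>2\<bar> \<le> 1 / weight y" for y
    using weight_ge_1[of y] by (simp add: field_simps power2_eq_square)
qed measurable

lemma tame_measurable: "tame f \<Longrightarrow> f \<in> borel_measurable borel"
  by (simp add: tame_def)

lemma wnorm2_nonneg [simp]: "0 \<le> wnorm2 f"
  unfolding wnorm2_def by (intro integral_nonneg_AE AE_I2) simp

lemma tame_integrable:
  assumes "tame f" shows "integrable lborel (\<lambda>y. \<bar>f y\<bar> / (weight y)\<^sup>2)"
    and "(\<integral>y. \<bar>f y\<bar> / (weight y)\<^sup>2 \<partial>lborel) \<le> (\<integral>y. 1 / (weight y)\<^sup>2 \<partial>lborel) + wnorm2 f"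
proof -
  have [measurable]: "f \<in> borel_measurable borel" and i: "integrable lborel (\<lambda>y. (f y)\<^sup>2 / (weight y)\<^sup>2)"
    using assms by (auto simp: tame_def)
  have le: "\<bar>f y\<bar> / (weight y)\<^sup>2 \<le> 1 / (weight y)\<^sup>2 + (f y)\<^sup>2 / (weight y)\<^sup>2" for y
  proof -
    have "0 \<le> (\<bar>f y\<bar> - 1)\<^sup>2" "0 \<le> (f y)\<^sup>2" by simp_all
    then have "\<bar>f y\<bar> \<le> 1 + (f y)\<^sup>2" by (simp add: power2_eq_square algebra_simps)
    then show ?thesis by (simp add: add_divide_distrib[symmetric] divide_right_mono)
  qed
  show 1: "integrable lborel (\<lambda>y. \<bar>f y\<bar> / (weight y)\<^sup>2)"
    by (rule Bochner_Integration.integrable_bound[OF Bochner_Integration.integrable_add[OF integrable_inverse_weight2 i]])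
       (use le in \<open>auto intro!: AE_I2 order_trans[OF le]\<close>)
  have "(\<integral>y. \<bar>f y\<bar> / (weight y)\<^sup>2 \<partial>lborel) \<le> (\<integral>y. 1 / (weight y)\<^sup>2 + (f y)\<^sup>2 / (weight y)\<^sup>2 \<partial>lborel)"
    by (rule integral_mono[OF 1 Bochner_Integration.integrable_add[OF integrable_inverse_weight2 i] le])
  also have "\<dots> = (\<integral>y. 1 / (weight y)\<^sup>2 \<partial>lborel) + wnorm2 f"
    unfolding wnorm2_def by (rule Bochner_Integration.integral_add[OF integrable_inverse_weight2 i])
  finally show "(\<integral>y. \<bar>f y\<bar> / (weight y)\<^sup>2 \<partial>lborel) \<le> (\<integral>y. 1 / (weight y)\<^sup>2 \<partial>lborel) + wnorm2 f" .
qed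

lemma conv_integrable:
  assumes f: "tame f" and k[measurable]: "k \<in> borel_measurable borel" and b: "\<And>z. \<bar>k z\<bar> \<le> C / (weight z)\<^sup>2"
  shows "integrable lborel (\<lambda>y. k (x - y) * f y)"
proof -
  have [measurable]: "f \<in> borel_measurable borel" using f by (rule tame_measurable)
  have C: "0 \<le> C" using order_trans[OF abs_ge_zero b[of 0]] by (simp add: weight_def)
  show ?thesis
  proof (rule Bochner_Integration.integrable_bound[OF integrable_mult_right[OF tame_integrable(1)[OF f], of "C * (2 * weight x)\<^sup>2"]])
    have "\<bar>k (x - y) * f y\<bar> \<le> C * (2 * weight x)\<^sup>2 * (\<bar>f y\<bar> / (weight y)\<^sup>2)" for y
    proof -
      have "(weight y)\<^sup>2 \<le> (2 * weight x * weight (x - y))\<^sup>2" by (rule power_mono[OF weight_shift]) simp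
      then have "1 / (weight (x - y))\<^sup>2 \<le> (2 * weight x)\<^sup>2 / (weight y)\<^sup>2"
        by (simp add: field_simps power_mult_distrib)
      then have "C * (1 / (weight (x - y))\<^sup>2) \<le> C * ((2 * weight x)\<^sup>2 / (weight y)\<^sup>2)"
        using C by (rule mult_left_mono)
      then have "\<bar>k (x - y)\<bar> \<le> C * (2 * weight x)\<^sup>2 / (weight y)\<^sup>2" using b[of "x - y"] by simp
      then have "\<bar>k (x - y)\<bar> * \<bar>f y\<bar> \<le> C * (2 * weight x)\<^sup>2 / (weight y)\<^sup>2 * \<bar>f y\<bar>" by (rule mult_right_mono) simp
      then show ?thesis by (simp add: abs_mult)
    qed
    then show "AE y in lborel. norm (k (x - y) * f y) \<le> norm (C * (2 * weight x)\<^sup>2 * (\<bar>f y\<bar> / (weight y)\<^sup>2))"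
      unfolding real_norm_def by (intro AE_I2 order_trans[OF _ abs_ge_self])
  qed measurable
qed

lemma exp_cubic_bound:
  fixes a v :: real
  assumes "0 \<le> a" "0 \<le> v" "a \<le> 1" shows "(a / 3)^3 * (1 + v)^3 \<le> exp (a * v)"
proof -
  have "a / 3 * (1 + v) \<le> 1 + a * v / 3" using assms by (simp add: field_simps)
  also have "\<dots> \<le> exp (a * v / 3)" by (rule exp_ge_add_one_self)
  finally have "(a / 3 * (1 + v))^3 \<le> exp (a * v / 3)^3" using assms by (intro power_mono) auto
  also have "\<dots> = exp (a * v)" by (simp flip: exp_of_nat_mult)
  finally show ?thesis unfolding power_mult_distrib .
qed

lemma heat_kernel_decay:
  assumes "0 < \<delta>" "\<delta> \<le> L"
  obtains C where "0 < C" "\<And>s z. \<delta> \<le> s \<Longrightarrow> s \<le> L \<Longrightarrow> heat_kernel s z \<le> C / (weight z)^3"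
proof -
  define a where "a = min 1 (1 / (4 * L))"
  define C where "C = 1 / sqrt (4 * pi * \<delta>) / (a / 3)^3"
  have a: "0 < a" "a \<le> 1" using assms by (auto simp: a_def)
  show ?thesis
  proof (rule that[of C])
    show "0 < C" using a assms by (simp add: C_def)
    fix s z assume s: "\<delta> \<le> s" "s \<le> L"
    have "1 / (4 * L) \<le> 1 / (4 * s)" using s assms by (simp add: field_simps)
    then have as: "a \<le> 1 / (4 * s)" by (simp add: a_def)
    have "(a / 3)^3 * (weight z)^3 \<le> exp (a * z\<^sup>2)"
      unfolding weight_def by (rule exp_cubic_bound) (use a in auto)
    also have "\<dots> \<le> exp (z\<^sup>2 / (4 * s))"
      using mult_right_mono[OF as, of "z\<^sup>2"] by simp
    finally have "exp (- z\<^sup>2 / (4 * s)) \<le> 1 / ((a / 3)^3 * (weight z)^3)"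
      using a by (simp add: exp_minus field_simps)
    moreover have "1 / sqrt (4 * pi * s) \<le> 1 / sqrt (4 * pi * \<delta>)"
      using s assms by (intro divide_left_mono real_sqrt_le_mono) auto
    ultimately have "exp (- z\<^sup>2 / (4 * s)) * (1 / sqrt (4 * pi * s)) \<le> 1 / ((a / 3)^3 * (weight z)^3) * (1 / sqrt (4 * pi * \<delta>))"
      using a s assms by (intro mult_mono) auto
    then show "heat_kernel s z \<le> C / (weight z)^3" by (simp add: heat_kernel_def C_def field_simps)
  qed
qed

lemma heat_kernel_nonneg: "0 < s \<Longrightarrow> 0 \<le> heat_kernel s z"
  by (simp add: heat_kernel_def)

lemma heat_kernel_derivs_decay:
  assumes "0 < \<delta>" "\<delta> \<le> L"
  obtains C where "0 < C"
    "\<And>s z. \<delta> \<le> s \<Longrightarrow> s \<le> L \<Longrightarrow> \<bar>heat_kernel s z\<bar> \<le> C / (weight z)\<^sup>2"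
    "\<And>s z. \<delta> \<le> s \<Longrightarrow> s \<le> L \<Longrightarrow> \<bar>heat_kernel' s z\<bar> \<le> C / (weight z)\<^sup>2"
    "\<And>s z. \<delta> \<le> s \<Longrightarrow> s \<le> L \<Longrightarrow> \<bar>heat_kernel'' s z\<bar> \<le> C / (weight z)\<^sup>2"
proof -
  obtain C where C: "0 < C" "\<And>s z. \<delta> \<le> s \<Longrightarrow> s \<le> L \<Longrightarrow> heat_kernel s z \<le> C / (weight z)^3"
    using heat_kernel_decay[OF assms] by blast
  define A where "A = 1 + 1 / (2 * \<delta>) + 1 / (4 * \<delta>\<^sup>2)"
  have A1: "1 \<le> A" "1 / (2 * \<delta>) \<le> A" "1 / (4 * \<delta>\<^sup>2) + 1 / (2 * \<delta>) \<le> A"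
    using assms by (simp_all add: A_def)
  have key: "\<bar>p * heat_kernel s z\<bar> \<le> A * C / (weight z)\<^sup>2"
    if s: "\<delta> \<le> s" "s \<le> L" and p: "\<bar>p\<bar> \<le> A * weight z" for p s z
  proof -
    have "\<bar>p * heat_kernel s z\<bar> \<le> (A * weight z) * (C / (weight z)^3)"
      unfolding abs_mult using C(2)[OF s, of z] p heat_kernel_nonneg[of s z] s assms
      by (intro mult_mono) auto
    also have "\<dots> = A * C / (weight z)\<^sup>2" by (simp add: field_simps power2_eq_square power3_eq_cube)
    finally show ?thesis .
  qed
  have d1: "1 / (2 * s) \<le> 1 / (2 * \<delta>)" if "\<delta> \<le> s" for s using that assms by (simp add: field_simps)
  have d2: "1 / (4 * s\<^sup>2) \<le> 1 / (4 * \<delta>\<^sup>2)" if "\<delta> \<le> s" for s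
    using that assms by (intro divide_left_mono mult_left_mono power_mono) auto
  have zw: "\<bar>z\<bar> \<le> weight z" "z\<^sup>2 \<le> weight z" for z
  proof -
    have "0 \<le> (\<bar>z\<bar> - 1)\<^sup>2" "0 \<le> z\<^sup>2" by simp_all
    then show "\<bar>z\<bar> \<le> weight z" by (simp add: weight_def power2_eq_square algebra_simps)
  qed (simp add: weight_def)
  show ?thesis
  proof (rule that[of "A * C"])
    show "0 < A * C" using A1(1) C(1) by simp
    fix s z assume s: "\<delta> \<le> s" "s \<le> L"
    have s0: "0 < s" using s assms by simp
    show "\<bar>heat_kernel s z\<bar> \<le> A * C / (weight z)\<^sup>2"
      using key[OF s, of 1 z] mult_mono[of 1 A 1 "weight z"] A1(1) weight_ge_1[of z] by simp
    have "\<bar>- z / (2 * s)\<bar> = 1 / (2 * s) * \<bar>z\<bar>" using s0 by simp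
    also have "\<dots> \<le> A * weight z"
      using d1[OF s(1)] A1 s0 zw(1)[of z] by (intro mult_mono) auto
    finally show "\<bar>heat_kernel' s z\<bar> \<le> A * C / (weight z)\<^sup>2"
      unfolding heat_kernel'_def by (rule key[OF s])
    have "\<bar>z\<^sup>2 / (4 * s\<^sup>2) - 1 / (2 * s)\<bar> \<le> 1 / (4 * s\<^sup>2) * z\<^sup>2 + 1 / (2 * s) * 1"
      using s0 by (intro order_trans[OF abs_triangle_ineq4]) simp
    also have "\<dots> \<le> 1 / (4 * \<delta>\<^sup>2) * weight z + 1 / (2 * \<delta>) * weight z"
      using d1[OF s(1)] d2[OF s(1)] s0 assms zw(2)[of z] weight_ge_1[of z] by (intro add_mono mult_mono) auto
    also have "\<dots> = (1 / (4 * \<delta>\<^sup>2) + 1 / (2 * \<delta>)) * weight z" by (simp add: algebra_simps)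
    also have "\<dots> \<le> A * weight z" using A1(3) by (rule mult_right_mono) simp
    finally show "\<bar>heat_kernel'' s z\<bar> \<le> A * C / (weight z)\<^sup>2"
      unfolding heat_kernel''_def by (rule key[OF s])
  qed
qed

lemma heat_kernel_deriv:
  assumes "0 < t"
  shows "(heat_kernel t has_real_derivative heat_kernel' t x) (at x)"
proof -
  have "((\<lambda>x. exp (- x\<^sup>2 / (4 * t)) / sqrt (4 * pi * t)) has_real_derivative
      exp (- x\<^sup>2 / (4 * t)) * (- (2 * x) / (4 * t)) / sqrt (4 * pi * t)) (at x)"
    using assms by (intro DERIV_cdivide) (auto intro!: derivative_eq_intros)
  then show ?thesis
    by (simp add: heat_kernel_def[abs_def] heat_kernel'_def mult.commute)
qed

lemma heat_kernel'_deriv: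
  assumes "0 < t"
  shows "(heat_kernel' t has_real_derivative heat_kernel'' t x) (at x)"
proof -
  have "((\<lambda>x. - x / (2 * t) * heat_kernel t x) has_real_derivative
      - 1 / (2 * t) * heat_kernel t x + heat_kernel' t x * (- x / (2 * t))) (at x)"
    using assms by (intro DERIV_mult heat_kernel_deriv) (auto intro!: derivative_eq_intros)
  moreover have "- 1 / (2 * t) * heat_kernel t x + heat_kernel' t x * (- x / (2 * t)) = heat_kernel'' t x"
    using assms by (simp add: heat_kernel'_def heat_kernel''_def field_simps power2_eq_square)
  ultimately show ?thesis by (simp add: heat_kernel'_def[abs_def])
qed

lemma heat_kernel'_lipschitz:
  assumes "0 < \<delta>" "\<delta> \<le> L"
  obtains C where "0 < C" "\<And>s z h. \<delta> \<le> s \<Longrightarrow> s \<le> L \<Longrightarrow> \<bar>h\<bar> \<le> 1 \<Longrightarrow>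
     \<bar>heat_kernel' s (z + h) - heat_kernel' s z\<bar> \<le> C * \<bar>h\<bar> / (weight z)\<^sup>2"
proof -
  obtain C where C: "0 < C"
    "\<And>s z. \<delta> \<le> s \<Longrightarrow> s \<le> L \<Longrightarrow> \<bar>heat_kernel'' s z\<bar> \<le> C / (weight z)\<^sup>2"
    by (rule heat_kernel_derivs_decay[OF assms]) (rule that)
  show ?thesis
  proof (rule that[of "9 * C"])
    fix s z h :: real assume s: "\<delta> \<le> s" "s \<le> L" and h: "\<bar>h\<bar> \<le> 1"
    have "norm (heat_kernel' s (z + h) - heat_kernel' s z) \<le> 9 * C / (weight z)\<^sup>2 * norm ((z + h) - z)"
    proof (rule field_differentiable_bound)
      show "convex (closed_segment z (z + h))" by (rule convex_closed_segment)
      fix x assume x: "x \<in> closed_segment z (z + h)"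
      show "(heat_kernel' s has_field_derivative heat_kernel'' s x) (at x within closed_segment z (z + h))"
        by (rule has_field_derivative_at_within[OF heat_kernel'_deriv]) (use s assms in simp)
      have "\<bar>x - z\<bar> \<le> 1" using segment_bound1[OF x] h by (simp add: dist_real_def)
      then have "weight z \<le> 3 * weight x" by (rule weight_near)
      then have "(weight z)\<^sup>2 \<le> (3 * weight x)\<^sup>2" by (rule power_mono) simp
      then have "1 / (weight x)\<^sup>2 \<le> 9 / (weight z)\<^sup>2" by (simp add: field_simps)
      then have "C * (1 / (weight x)\<^sup>2) \<le> C * (9 / (weight z)\<^sup>2)" by (rule mult_left_mono) (use C in simp)
      then show "norm (heat_kernel'' s x) \<le> 9 * C / (weight z)\<^sup>2"
        using C(2)[OF s, of x] by (simp add: mult.commute)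
    qed auto
    then show "\<bar>heat_kernel' s (z + h) - heat_kernel' s z\<bar> \<le> 9 * C * \<bar>h\<bar> / (weight z)\<^sup>2" by simp
  qed (use C in simp)
qed

lemma heat_kernel_taylor:
  assumes "0 < s"
  obtains C where "0 < C" "\<And>z h. \<bar>h\<bar> \<le> 1 \<Longrightarrow>
     \<bar>heat_kernel s (z + h) - heat_kernel s z - h * heat_kernel' s z\<bar> \<le> C * h\<^sup>2 / (weight z)\<^sup>2"
proof -
  obtain C where C0: "0 < C" "\<And>r z h. s \<le> r \<Longrightarrow> r \<le> s \<Longrightarrow> \<bar>h\<bar> \<le> 1 \<Longrightarrow>
     \<bar>heat_kernel' r (z + h) - heat_kernel' r z\<bar> \<le> C * \<bar>h\<bar> / (weight z)\<^sup>2"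
    by (rule heat_kernel'_lipschitz[OF assms order_refl]) (rule that)
  note C = C0(1) C0(2)[OF order_refl order_refl]
  show ?thesis
  proof (rule that[OF C0(1)])
    fix z h :: real assume h: "\<bar>h\<bar> \<le> 1"
    let ?F = "\<lambda>x. heat_kernel s x - x * heat_kernel' s z"
    have "norm (?F (z + h) - ?F z) \<le> C * \<bar>h\<bar> / (weight z)\<^sup>2 * norm ((z + h) - z)"
    proof (rule field_differentiable_bound)
      show "convex (closed_segment z (z + h))" by (rule convex_closed_segment)
      fix x assume x: "x \<in> closed_segment z (z + h)"
      show "(?F has_field_derivative heat_kernel' s x - heat_kernel' s z) (at x within closed_segment z (z + h))"
        by (rule has_field_derivative_at_within)
          (auto intro!: derivative_eq_intros heat_kernel_deriv[OF assms])
      have xz: "\<bar>x - z\<bar> \<le> \<bar>h\<bar>" using segment_bound1[OF x] by (simp add: dist_real_def)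
      have "\<bar>heat_kernel' s (z + (x - z)) - heat_kernel' s z\<bar> \<le> C * \<bar>x - z\<bar> / (weight z)\<^sup>2"
        by (rule C(2)) (use xz h in simp)
      also have "\<dots> \<le> C * \<bar>h\<bar> / (weight z)\<^sup>2" using xz C(1) by (intro divide_right_mono mult_left_mono) auto
      finally show "norm (heat_kernel' s x - heat_kernel' s z) \<le> C * \<bar>h\<bar> / (weight z)\<^sup>2" by simp
    qed auto
    then show "\<bar>heat_kernel s (z + h) - heat_kernel s z - h * heat_kernel' s z\<bar> \<le> C * h\<^sup>2 / (weight z)\<^sup>2"
      by (simp add: algebra_simps power2_eq_square)
  qed
qed

lemma heat_conv_integrable:
  assumes "tame f" "0 < t"
  shows "integrable lborel (\<lambda>y. heat_kernel t (x - y) * f y)"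
    and "integrable lborel (\<lambda>y. heat_kernel' t (x - y) * f y)"
proof -
  obtain C where "\<And>s z. t \<le> s \<Longrightarrow> s \<le> t \<Longrightarrow> \<bar>heat_kernel s z\<bar> \<le> C / (weight z)\<^sup>2"
      "\<And>s z. t \<le> s \<Longrightarrow> s \<le> t \<Longrightarrow> \<bar>heat_kernel' s z\<bar> \<le> C / (weight z)\<^sup>2"
    by (rule heat_kernel_derivs_decay[OF assms(2) order_refl]) (rule that)
  then have C: "\<And>z. \<bar>heat_kernel t z\<bar> \<le> C / (weight z)\<^sup>2" "\<And>z. \<bar>heat_kernel' t z\<bar> \<le> C / (weight z)\<^sup>2"
    by simp_all
  show "integrable lborel (\<lambda>y. heat_kernel t (x - y) * f y)"
    by (rule conv_integrable[OF assms(1) _ C(1)]) measurable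
  show "integrable lborel (\<lambda>y. heat_kernel' t (x - y) * f y)"
    by (rule conv_integrable[OF assms(1) _ C(2)]) measurable
qed

lemma weight_conv_bound:
  assumes f: "tame f" and b: "\<And>y. \<bar>k y\<bar> \<le> c / (weight (x - y))\<^sup>2"
    and i: "integrable lborel (\<lambda>y. k y * f y)" and c: "0 \<le> c"
  shows "\<bar>\<integral>y. k y * f y \<partial>lborel\<bar> \<le> c * (2 * weight x)\<^sup>2 * ((\<integral>y. 1 / (weight y)\<^sup>2 \<partial>lborel) + wnorm2 f)"
proof -
  have le: "\<bar>k y * f y\<bar> \<le> c * (2 * weight x)\<^sup>2 * (\<bar>f y\<bar> / (weight y)\<^sup>2)" for y
  proof -
    have "(weight y)\<^sup>2 \<le> (2 * weight x * weight (x - y))\<^sup>2" by (rule power_mono[OF weight_shift]) simp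
    then have "1 / (weight (x - y))\<^sup>2 \<le> (2 * weight x)\<^sup>2 / (weight y)\<^sup>2"
      by (simp add: field_simps power_mult_distrib)
    then have "c * (1 / (weight (x - y))\<^sup>2) \<le> c * ((2 * weight x)\<^sup>2 / (weight y)\<^sup>2)"
      using c by (rule mult_left_mono)
    then have "\<bar>k y\<bar> \<le> c * (2 * weight x)\<^sup>2 / (weight y)\<^sup>2" using b[of y] by simp
    then have "\<bar>k y\<bar> * \<bar>f y\<bar> \<le> c * (2 * weight x)\<^sup>2 / (weight y)\<^sup>2 * \<bar>f y\<bar>" by (rule mult_right_mono) simp
    then show ?thesis by (simp add: abs_mult)
  qed
  have "\<bar>\<integral>y. k y * f y \<partial>lborel\<bar> \<le> (\<integral>y. \<bar>k y * f y\<bar> \<partial>lborel)" by (rule integral_abs_bound)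
  also have "\<dots> \<le> (\<integral>y. c * (2 * weight x)\<^sup>2 * (\<bar>f y\<bar> / (weight y)\<^sup>2) \<partial>lborel)"
    by (intro integral_mono le integrable_abs i integrable_mult_right tame_integrable(1) f)
  also have "\<dots> \<le> c * (2 * weight x)\<^sup>2 * ((\<integral>y. 1 / (weight y)\<^sup>2 \<partial>lborel) + wnorm2 f)"
    unfolding integral_mult_right_zero using tame_integrable(2)[OF f] c by (intro mult_left_mono) auto
  finally show ?thesis .
qed

lemma heat_conv_deriv:
  assumes f: "tame f" and t: "0 < t"
  shows "((\<lambda>z. \<integral>y. heat_kernel t (z - y) * f y \<partial>lborel) has_real_derivative heat_conv' f t x) (at x)"
proof -
  obtain C where C: "0 < C" "\<And>z h. \<bar>h\<bar> \<le> 1 \<Longrightarrow>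
     \<bar>heat_kernel t (z + h) - heat_kernel t z - h * heat_kernel' t z\<bar> \<le> C * h\<^sup>2 / (weight z)\<^sup>2"
    by (rule heat_kernel_taylor[OF t]) (rule that)
  define V where "V z = (\<integral>y. heat_kernel t (z - y) * f y \<partial>lborel)" for z
  define D where "D = (2 * weight x)\<^sup>2 * ((\<integral>y. 1 / (weight y)\<^sup>2 \<partial>lborel) + wnorm2 f)"
  note int = heat_conv_integrable[OF f t]
  have bnd: "\<bar>(V (x + h) - V x) / h - heat_conv' f t x\<bar> \<le> C * D * \<bar>h\<bar>" if h: "h \<noteq> 0" "\<bar>h\<bar> \<le> 1" for h
  proof -
    let ?k = "\<lambda>y. heat_kernel t (x + h - y) - heat_kernel t (x - y) - h * heat_kernel' t (x - y)"
    have i: "integrable lborel (\<lambda>y. ?k y * f y)"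
      using int[of "x + h"] int[of x] by (simp add: left_diff_distrib mult.assoc)
    have eq: "V (x + h) - V x - h * heat_conv' f t x = (\<integral>y. ?k y * f y \<partial>lborel)"
      using int[of "x + h"] int[of x] by (simp add: V_def heat_conv'_def left_diff_distrib mult.assoc)
    have "\<bar>\<integral>y. ?k y * f y \<partial>lborel\<bar> \<le> C * h\<^sup>2 * (2 * weight x)\<^sup>2 * ((\<integral>y. 1 / (weight y)\<^sup>2 \<partial>lborel) + wnorm2 f)"
    proof (rule weight_conv_bound[OF f _ i])
      fix y show "\<bar>?k y\<bar> \<le> C * h\<^sup>2 / (weight (x - y))\<^sup>2"
        using C(2)[OF h(2), of "x - y"] by (simp add: algebra_simps)
    qed (use C in simp)
    then have *: "\<bar>V (x + h) - V x - h * heat_conv' f t x\<bar> \<le> C * h\<^sup>2 * D"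
      unfolding eq D_def by (simp add: mult.assoc)
    have "\<bar>(V (x + h) - V x) / h - heat_conv' f t x\<bar> = \<bar>V (x + h) - V x - h * heat_conv' f t x\<bar> / \<bar>h\<bar>"
      unfolding abs_divide[symmetric] using h by (simp add: diff_divide_distrib)
    also have "\<dots> \<le> C * h\<^sup>2 * D / \<bar>h\<bar>" using * by (rule divide_right_mono) simp
    also have "\<dots> = C * D * (h\<^sup>2 / \<bar>h\<bar>)" by simp
    also have "h\<^sup>2 / \<bar>h\<bar> = \<bar>h\<bar>" by (metis abs_mult_self_eq nonzero_mult_div_cancel_left abs_eq_0 h(1) power2_eq_square)
    finally show ?thesis .
  qed
  have "((\<lambda>h. (V (x + h) - V x) / h - heat_conv' f t x) \<longlongrightarrow> 0) (at 0)"
  proof (rule Lim_null_comparison)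
    show "\<forall>\<^sub>F h in at 0. norm ((V (x + h) - V x) / h - heat_conv' f t x) \<le> C * D * \<bar>h\<bar>"
      unfolding eventually_at using bnd by (intro exI[of _ 1]) (auto simp: dist_real_def)
    show "((\<lambda>h. C * D * \<bar>h\<bar>) \<longlongrightarrow> 0) (at 0)"
      by (auto intro!: tendsto_eq_intros)
  qed
  then have "((\<lambda>h. (V (x + h) - V x) / h) \<longlongrightarrow> heat_conv' f t x) (at 0)" by (simp add: LIM_zero_iff)
  then show ?thesis unfolding V_def DERIV_def by simp
qed

lemma velocity_eq_heat_conv:
  assumes "tame (\<lambda>y. B y \<omega>)" "0 < t"
  shows "velocity B t x \<omega> = - heat_conv' (\<lambda>y. B y \<omega>) t x"
  using DERIV_imp_deriv[OF heat_conv_deriv[OF assms, of x]] assms(2)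
  by (simp add: velocity_def potential_def)

lemma heat_conv'_lipschitz:
  assumes "0 < \<delta>" "\<delta> \<le> L"
  obtains C where "0 < C" "\<And>f s x. tame f \<Longrightarrow> \<delta> \<le> s \<Longrightarrow> s \<le> L \<Longrightarrow> \<bar>x\<bar> \<le> 1 \<Longrightarrow>
     \<bar>heat_conv' f s x - heat_conv' f s 0\<bar> \<le> C * (1 + wnorm2 f) * \<bar>x\<bar>"
proof -
  obtain C where C: "0 < C" "\<And>s z h. \<delta> \<le> s \<Longrightarrow> s \<le> L \<Longrightarrow> \<bar>h\<bar> \<le> 1 \<Longrightarrow>
     \<bar>heat_kernel' s (z + h) - heat_kernel' s z\<bar> \<le> C * \<bar>h\<bar> / (weight z)\<^sup>2"
    by (rule heat_kernel'_lipschitz[OF assms]) (rule that)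
  define I where "I = (\<integral>y. 1 / (weight y)\<^sup>2 \<partial>lborel)"
  have I: "0 \<le> I" unfolding I_def by (intro integral_nonneg_AE AE_I2) simp
  show ?thesis
  proof (rule that[of "4 * C * (1 + I)"])
    show "0 < 4 * C * (1 + I)" using C(1) I by simp
    fix f s x assume f: "tame f" and s: "\<delta> \<le> s" "s \<le> L" and x: "\<bar>x\<bar> \<le> (1::real)"
    have s0: "0 < s" using s assms by simp
    note int = heat_conv_integrable(2)[OF f s0]
    let ?k = "\<lambda>y. heat_kernel' s (x - y) - heat_kernel' s (0 - y)"
    have i: "integrable lborel (\<lambda>y. ?k y * f y)"
      using Bochner_Integration.integrable_diff[OF int[of x] int[of 0]] by (simp add: left_diff_distrib)
    have eq: "heat_conv' f s x - heat_conv' f s 0 = (\<integral>y. ?k y * f y \<partial>lborel)"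
      unfolding heat_conv'_def left_diff_distrib by (rule Bochner_Integration.integral_diff[OF int int, symmetric])
    have "\<bar>\<integral>y. ?k y * f y \<partial>lborel\<bar> \<le> C * \<bar>x\<bar> * (2 * weight 0)\<^sup>2 * ((\<integral>y. 1 / (weight y)\<^sup>2 \<partial>lborel) + wnorm2 f)"
    proof (rule weight_conv_bound[OF f _ i])
      fix y show "\<bar>?k y\<bar> \<le> C * \<bar>x\<bar> / (weight (0 - y))\<^sup>2"
        using C(2)[OF s x, of "- y"] by simp
    qed (use C in simp)
    also have "\<dots> = 4 * C * \<bar>x\<bar> * (I + wnorm2 f)" by (simp add: weight_def I_def)
    also have "\<dots> \<le> 4 * C * \<bar>x\<bar> * ((1 + I) * (1 + wnorm2 f))"
      using C(1) I mult_nonneg_nonneg[OF I wnorm2_nonneg[of f]] by (intro mult_left_mono) (auto simp: algebra_simps)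
    also have "\<dots> = 4 * C * (1 + I) * (1 + wnorm2 f) * \<bar>x\<bar>" by simp
    finally show "\<bar>heat_conv' f s x - heat_conv' f s 0\<bar> \<le> 4 * C * (1 + I) * (1 + wnorm2 f) * \<bar>x\<bar>"
      unfolding eq .
  qed
qed

lemma heat_kernel_normal_density: "0 < s \<Longrightarrow> heat_kernel s z = normal_density 0 (sqrt (2 * s)) z"
  by (simp add: heat_kernel_def normal_density_def)

lemma heat_kernel'_square_bound:
  assumes "0 < L"
  obtains C where "0 < C" "\<And>s z. 0 < s \<Longrightarrow> s \<le> L \<Longrightarrow>
     (heat_kernel' s z * weight z)\<^sup>2 \<le> C * s powr (-3/2) * heat_kernel s z"
proof -
  define C where "C = 1728 * (1 + L)\<^sup>2 * sqrt (4 * pi) / (16 * pi)"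
  show ?thesis
  proof (rule that[of C])
    show "0 < C" using assms by (simp add: C_def)
    fix s z :: real assume s: "0 < s" "s \<le> L"
    define v where "v = z\<^sup>2 / s"
    have v: "0 \<le> v" "z\<^sup>2 = s * v" using s by (auto simp: v_def)
    have e: "heat_kernel s z = exp (- v / 4) / sqrt (4 * pi * s)"
      using s by (simp add: heat_kernel_def v_def)
    have sq: "(exp (- v / 4))\<^sup>2 = exp (- v / 4) * exp (- v / 4)" by (simp add: power2_eq_square)
    have "(heat_kernel' s z * weight z)\<^sup>2 = (z\<^sup>2 / (4 * s\<^sup>2)) * (heat_kernel s z)\<^sup>2 * (1 + s * v)\<^sup>2"
      by (simp add: heat_kernel'_def weight_def v(2)[symmetric] power_mult_distrib power_divide)
    also have "\<dots> = v * (1 + s * v)\<^sup>2 * exp (- v / 4) * (exp (- v / 4) / (16 * pi * s\<^sup>2))"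
      using s unfolding e v(2) power_divide sq by (simp add: field_simps power2_eq_square)
    also have "\<dots> \<le> (1728 * (1 + L)\<^sup>2) * (exp (- v / 4) / (16 * pi * s\<^sup>2))"
    proof (rule mult_right_mono)
      have "1 + s * v \<le> (1 + L) * (1 + v)" using s v assms mult_right_mono[OF s(2) v(1)]
        by (simp add: algebra_simps)
      then have "(1 + s * v)\<^sup>2 \<le> ((1 + L) * (1 + v))\<^sup>2" using s v by (intro power_mono) auto
      then have "v * (1 + s * v)\<^sup>2 \<le> (1 + v) * ((1 + L) * (1 + v))\<^sup>2" using v by (intro mult_mono) auto
      also have "\<dots> = (1 + L)\<^sup>2 * (1 + v)^3" by (simp add: power2_eq_square power3_eq_cube)
      also have "\<dots> \<le> (1 + L)\<^sup>2 * (1728 * exp (v / 4))"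
        using exp_cubic_bound[of "1/4" v] v by (intro mult_left_mono) (auto simp: power3_eq_cube)
      finally have "v * (1 + s * v)\<^sup>2 * exp (- v / 4) \<le> (1 + L)\<^sup>2 * (1728 * exp (v / 4)) * exp (- v / 4)"
        by (rule mult_right_mono) simp
      also have "\<dots> = 1728 * (1 + L)\<^sup>2" by (simp add: exp_minus field_simps)
      finally show "v * (1 + s * v)\<^sup>2 * exp (- v / 4) \<le> 1728 * (1 + L)\<^sup>2" .
    qed (use s in simp)
    also have "\<dots> = C * (sqrt s / s\<^sup>2) * heat_kernel s z"
      using s by (simp add: C_def e real_sqrt_mult field_simps)
    also have "sqrt s / s\<^sup>2 = s powr (-3/2)"
    proof -
      have "sqrt s / s\<^sup>2 = s powr (1/2) / s powr 2" using s by (simp add: powr_half_sqrt)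
      also have "\<dots> = s powr (-3/2)" by (simp flip: powr_diff)
      finally show ?thesis .
    qed
    finally show "(heat_kernel' s z * weight z)\<^sup>2 \<le> C * s powr (-3/2) * heat_kernel s z" .
  qed
qed

text \<open>Here \<open>\<kappa>\<close> is the free parameter of the inequality \<open>2 * a * b \<le> l * a\<^sup>2 + b\<^sup>2 / l\<close>, which
  takes the place of Cauchy-Schwarz.\<close>

lemma heat_conv'_bound:
  assumes "0 < L"
  obtains C where "0 < C" "\<And>f s x \<kappa>. tame f \<Longrightarrow> 0 < s \<Longrightarrow> s \<le> L \<Longrightarrow> 0 < \<kappa> \<Longrightarrow>
     \<bar>heat_conv' f s x\<bar> \<le> weight x * s powr (-3/4) * (C * \<kappa> + wnorm2 f / \<kappa>)"
proof -
  obtain C where C: "0 < C" "\<And>s z. 0 < s \<Longrightarrow> s \<le> L \<Longrightarrow>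
     (heat_kernel' s z * weight z)\<^sup>2 \<le> C * s powr (-3/2) * heat_kernel s z"
    by (rule heat_kernel'_square_bound[OF assms]) (rule that)
  show ?thesis
  proof (rule that[OF C(1)])
    fix f s x \<kappa> assume f: "tame f" and s: "0 < s" "s \<le> L" and k: "0 < (\<kappa>::real)"
    have fi: "integrable lborel (\<lambda>y. (f y)\<^sup>2 / (weight y)\<^sup>2)" using f by (simp add: tame_def)
    have n1: "integrable lborel (\<lambda>y. heat_kernel s (x - y))" "(\<integral>y. heat_kernel s (x - y) \<partial>lborel) = 1"
    proof -
      have "integrable lborel (\<lambda>z. heat_kernel s z)" "(\<integral>z. heat_kernel s z \<partial>lborel) = 1"
        using s by (simp_all add: heat_kernel_normal_density integrable_normal_density integral_normal_density)
      then show "integrable lborel (\<lambda>y. heat_kernel s (x - y))" "(\<integral>y. heat_kernel s (x - y) \<partial>lborel) = 1"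
        using lborel_integrable_real_affine[of "heat_kernel s" "-1" x]
          lborel_integral_real_affine[of "-1" "heat_kernel s" x] by simp_all
    qed
    define l where "l = \<kappa> * s powr (3/4)"
    have l: "0 < l" using k s by (simp add: l_def)
    let ?R = "\<lambda>y. weight x * (l * C * s powr (-3/2) * heat_kernel s (x - y) + (1 / l) * ((f y)\<^sup>2 / (weight y)\<^sup>2))"
    have le: "\<bar>heat_kernel' s (x - y) * f y\<bar> \<le> ?R y" for y
    proof -
      define a where "a = \<bar>heat_kernel' s (x - y)\<bar> * weight (x - y)"
      define b where "b = \<bar>f y\<bar> / weight y"
      have ab: "0 \<le> a" "0 \<le> b" by (auto simp: a_def b_def)
      have "\<bar>heat_kernel' s (x - y) * f y\<bar> = weight y * (\<bar>heat_kernel' s (x - y)\<bar> * b)"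
        by (simp add: b_def abs_mult)
      also have "\<dots> \<le> 2 * weight x * weight (x - y) * (\<bar>heat_kernel' s (x - y)\<bar> * b)"
        by (rule mult_right_mono[OF weight_shift]) (use ab in simp)
      also have "\<dots> = weight x * (2 * (a * b))" by (simp add: a_def)
      also have "\<dots> \<le> weight x * (l * a\<^sup>2 + (1 / l) * b\<^sup>2)"
      proof (rule mult_left_mono)
        have "0 \<le> (l * a - b)\<^sup>2 / l" using l by simp
        also have "\<dots> = l * a\<^sup>2 + (1 / l) * b\<^sup>2 - 2 * (a * b)"
          using l by (simp add: power2_eq_square field_simps)
        finally show "2 * (a * b) \<le> l * a\<^sup>2 + (1 / l) * b\<^sup>2" by simp
      qed simp
      also have "\<dots> \<le> ?R y"
      proof -
        have "a\<^sup>2 \<le> C * s powr (-3/2) * heat_kernel s (x - y)"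
          using C(2)[OF s, of "x - y"] by (simp add: a_def power_mult_distrib)
        then have "l * a\<^sup>2 \<le> l * (C * s powr (-3/2) * heat_kernel s (x - y))" using l by (intro mult_left_mono) auto
        then have "l * a\<^sup>2 + (1 / l) * b\<^sup>2 \<le> l * C * s powr (-3/2) * heat_kernel s (x - y) + (1 / l) * ((f y)\<^sup>2 / (weight y)\<^sup>2)"
          by (simp add: b_def power_divide mult.assoc)
        then show ?thesis by (rule mult_left_mono) simp
      qed
      finally show ?thesis .
    qed
    have Ri: "integrable lborel ?R" using n1(1) fi by (intro integrable_mult_right Bochner_Integration.integrable_add)
    have "\<bar>heat_conv' f s x\<bar> \<le> (\<integral>y. \<bar>heat_kernel' s (x - y) * f y\<bar> \<partial>lborel)"
      unfolding heat_conv'_def by (rule integral_abs_bound)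
    also have "\<dots> \<le> (\<integral>y. ?R y \<partial>lborel)"
      by (intro integral_mono integrable_abs heat_conv_integrable(2) f s Ri le)
    also have "\<dots> = weight x * (l * C * s powr (-3/2) + (1 / l) * wnorm2 f)"
      unfolding wnorm2_def integral_mult_right_zero
      by (subst Bochner_Integration.integral_add)
        (use n1 fi in \<open>simp_all only: integral_mult_right_zero integrable_mult_right mult_1_right\<close>)
    also have "l * C * s powr (-3/2) = s powr (-3/4) * (C * \<kappa>)"
    proof -
      have "s powr (3/4) * s powr (-3/2) = s powr (-3/4)" by (simp flip: powr_add)
      then show ?thesis by (simp add: l_def algebra_simps)
    qed
    also have "(1 / l) * wnorm2 f = s powr (-3/4) * (wnorm2 f / \<kappa>)"
      using k s by (simp add: l_def powr_minus field_simps)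
    finally show "\<bar>heat_conv' f s x\<bar> \<le> weight x * s powr (-3/4) * (C * \<kappa> + wnorm2 f / \<kappa>)"
      by (simp add: algebra_simps)
  qed
qed

lemma heat_conv'_measurable [measurable (raw)]:
  assumes [measurable]: "f \<in> borel_measurable borel" "g \<in> borel_measurable M" "h \<in> borel_measurable M"
  shows "(\<lambda>s. heat_conv' f (g s) (h s)) \<in> borel_measurable M"
  unfolding heat_conv'_def by measurable

section \<open>Comparison of the driven path with the integrated velocity at the origin\<close>

definition vel_int :: "(real \<Rightarrow> real) \<Rightarrow> real \<Rightarrow> real" where
  "vel_int f \<theta> = integral {0..\<theta>} (\<lambda>s. - heat_conv' f s 0)"

lemma heat_conv'_0 [simp]: "heat_conv' f 0 x = 0"
  by (simp add: heat_conv'_def heat_kernel'_def)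

lemma has_integral_powr: "0 \<le> L \<Longrightarrow> ((\<lambda>s. s powr (-3/4)) has_integral 4 * L powr (1/4)) {0..L::real}"
  using has_integral_powr_from_0[of "-3/4" L] by (simp add: mult.commute)

lemma heat_conv'_set_integrable:
  assumes f: "tame f"
  shows "set_integrable lborel {0..L} (\<lambda>s. heat_conv' f s 0)"
proof -
  have [measurable]: "f \<in> borel_measurable borel" using f by (rule tame_measurable)
  have m: "(\<lambda>s. indicator {0..L} s *\<^sub>R heat_conv' f s 0) \<in> borel_measurable lborel" by measurable
  show ?thesis
  proof (cases "0 < L")
    case True
    obtain C where C: "0 < C" "\<And>f s x \<kappa>. tame f \<Longrightarrow> 0 < s \<Longrightarrow> s \<le> L \<Longrightarrow> 0 < \<kappa> \<Longrightarrow>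
     \<bar>heat_conv' f s x\<bar> \<le> weight x * s powr (-3/4) * (C * \<kappa> + wnorm2 f / \<kappa>)"
      by (rule heat_conv'_bound[OF True]) (rule that)
    define A where "A = C + wnorm2 f"
    have A: "0 \<le> A" using C(1) by (simp add: A_def)
    have b: "\<bar>heat_conv' f s 0\<bar> \<le> A * s powr (-3/4)" if "s \<in> {0..L}" for s
      using that C(2)[OF f, of s 1 0] by (cases "s = 0") (auto simp: A_def weight_def mult.commute)
    have p: "(\<lambda>s. s powr (-3/4)) absolutely_integrable_on {0..L}"
      using has_integral_powr[of L] True by (intro nonnegative_absolutely_integrable_1) auto
    have "set_integrable lebesgue {0..L} (\<lambda>s. heat_conv' f s 0)"
      unfolding set_integrable_def
    proof (rule Bochner_Integration.integrable_bound)
      show "integrable lebesgue (\<lambda>s. A * (indicator {0..L} s *\<^sub>R s powr (-3/4)))"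
        using p unfolding set_integrable_def by (rule integrable_mult_right)
      show "(\<lambda>s. indicator {0..L} s *\<^sub>R heat_conv' f s 0) \<in> borel_measurable lebesgue"
        using m by (rule measurable_completion)
      show "AE s in lebesgue. norm (indicator {0..L} s *\<^sub>R heat_conv' f s 0)
          \<le> norm (A * (indicator {0..L} s *\<^sub>R s powr (-3/4)))"
        using b A by (intro AE_I2) (auto simp: indicator_def abs_mult)
    qed
    then show ?thesis unfolding set_integrable_def using m by (simp add: integrable_completion)
  next
    case False
    have "(\<lambda>s. indicator {0..L} s *\<^sub>R heat_conv' f s 0) = (\<lambda>s. 0)"
      using False by (auto simp: fun_eq_iff indicator_def) (metis heat_conv'_0 order_antisym_conv order_trans not_less)
    then show ?thesis by (simp add: set_integrable_def)
  qed
qed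

lemma heat_conv'_integrable_on: "tame f \<Longrightarrow> (\<lambda>s. - heat_conv' f s 0) integrable_on {0..L}"
  using set_borel_integral_eq_integral(1)[OF heat_conv'_set_integrable] by (simp add: integrable_neg)

lemma vel_int_eq_LINT:
  assumes "tame f" shows "vel_int f \<theta> = (LINT s:{0..\<theta>}|lborel. - heat_conv' f s 0)"
proof -
  have "set_integrable lborel {0..\<theta>} (\<lambda>s. - heat_conv' f s 0)"
    using heat_conv'_set_integrable[OF assms, of \<theta>] by (simp add: set_integrable_def)
  from set_borel_integral_eq_integral(2)[OF this] show ?thesis by (simp add: vel_int_def)
qed

lemma vel_int_continuous:
  assumes "tame f" shows "continuous_on {0..} (vel_int f)"
  unfolding continuous_on_eq_continuous_within
proof
  fix x :: real assume x: "x \<in> {0..}"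
  have "continuous_on {0..x+1} (vel_int f)"
    unfolding vel_int_def[abs_def] by (rule indefinite_integral_continuous_1[OF heat_conv'_integrable_on[OF assms]])
  then have "continuous (at x within {0..x+1}) (vel_int f)"
    using x by (simp add: continuous_on_eq_continuous_within)
  moreover have "at x within {0..} = at x within {0..x+1}"
    by (rule at_within_nhd[of x "{..<x+1}"]) auto
  ultimately show "continuous (at x within {0..}) (vel_int f)" by simp
qed

lemma tame_diff:
  assumes "tame f" "tame g" shows "tame (\<lambda>y. f y - g y)"
proof -
  have [measurable]: "f \<in> borel_measurable borel" "g \<in> borel_measurable borel"
    using assms by (auto intro: tame_measurable)
  have "integrable lborel (\<lambda>y. (f y - g y)\<^sup>2 / (weight y)\<^sup>2)"
  proof (rule Bochner_Integration.integrable_bound)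
    show "integrable lborel (\<lambda>y. 2 * ((f y)\<^sup>2 / (weight y)\<^sup>2) + 2 * ((g y)\<^sup>2 / (weight y)\<^sup>2))"
      using assms by (intro Bochner_Integration.integrable_add integrable_mult_right) (auto simp: tame_def)
    have "(f y - g y)\<^sup>2 / (weight y)\<^sup>2 \<le> 2 * ((f y)\<^sup>2 / (weight y)\<^sup>2) + 2 * ((g y)\<^sup>2 / (weight y)\<^sup>2)" for y
    proof -
      have "(f y - g y)\<^sup>2 \<le> 2 * (f y)\<^sup>2 + 2 * (g y)\<^sup>2"
        using zero_le_power2[of "f y + g y"] by (simp add: power2_eq_square algebra_simps)
      then have "(f y - g y)\<^sup>2 / (weight y)\<^sup>2 \<le> (2 * (f y)\<^sup>2 + 2 * (g y)\<^sup>2) / (weight y)\<^sup>2"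
        by (rule divide_right_mono) simp
      then show ?thesis by (simp add: add_divide_distrib)
    qed
    then show "AE y in lborel. norm ((f y - g y)\<^sup>2 / (weight y)\<^sup>2)
        \<le> norm (2 * ((f y)\<^sup>2 / (weight y)\<^sup>2) + 2 * ((g y)\<^sup>2 / (weight y)\<^sup>2))"
      by (intro AE_I2) simp
  qed measurable
  then show ?thesis by (simp add: tame_def)
qed

lemma heat_conv'_diff:
  assumes "tame f" "tame g" "0 \<le> s"
  shows "heat_conv' (\<lambda>y. f y - g y) s x = heat_conv' f s x - heat_conv' g s x"
proof (cases "s = 0")
  case False
  then have s: "0 < s" using assms by simp
  show ?thesis unfolding heat_conv'_def right_diff_distrib
    by (rule Bochner_Integration.integral_diff[OF heat_conv_integrable(2)[OF assms(1) s] heat_conv_integrable(2)[OF assms(2) s]])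
qed simp

lemma vel_int_diff_bound:
  assumes "0 < L"
  obtains C where "0 < C" "\<And>f g \<kappa> \<theta>. tame f \<Longrightarrow> tame g \<Longrightarrow> 0 < \<kappa> \<Longrightarrow> \<theta> \<in> {0..L} \<Longrightarrow>
     \<bar>vel_int f \<theta> - vel_int g \<theta>\<bar> \<le> C * (\<kappa> + wnorm2 (\<lambda>y. f y - g y) / \<kappa>)"
proof -
  obtain C where C: "0 < C" "\<And>f s x \<kappa>. tame f \<Longrightarrow> 0 < s \<Longrightarrow> s \<le> L \<Longrightarrow> 0 < \<kappa> \<Longrightarrow>
     \<bar>heat_conv' f s x\<bar> \<le> weight x * s powr (-3/4) * (C * \<kappa> + wnorm2 f / \<kappa>)"
    by (rule heat_conv'_bound[OF assms]) (rule that)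
  show ?thesis
  proof (rule that[of "(C + 1) * (4 * L powr (1/4))"])
    show "0 < (C + 1) * (4 * L powr (1/4))" using C(1) assms by simp
    fix f g \<kappa> \<theta> assume f: "tame f" and g: "tame g" and k: "0 < (\<kappa>::real)" and \<theta>: "\<theta> \<in> {0..L}"
    let ?h = "\<lambda>y. f y - g y"
    have h: "tame ?h" by (rule tame_diff[OF f g])
    define A where "A = C * \<kappa> + wnorm2 ?h / \<kappa>"
    have w: "0 \<le> wnorm2 ?h / \<kappa>" using k by simp
    have A: "0 \<le> A" "A \<le> (C + 1) * (\<kappa> + wnorm2 ?h / \<kappa>)"
      using C(1) k w mult_nonneg_nonneg[OF less_imp_le[OF C(1)] w] unfolding A_def distrib_left distrib_right by auto
    have "\<bar>vel_int f \<theta> - vel_int g \<theta>\<bar> = norm (integral {0..\<theta>} (\<lambda>s. - heat_conv' ?h s 0))"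
    proof -
      have "vel_int f \<theta> - vel_int g \<theta> = integral {0..\<theta>} (\<lambda>s. - heat_conv' f s 0 - - heat_conv' g s 0)"
        unfolding vel_int_def by (rule integral_diff[symmetric]; rule heat_conv'_integrable_on) (rule f g)+
      also have "\<dots> = integral {0..\<theta>} (\<lambda>s. - heat_conv' ?h s 0)"
        by (rule integral_cong) (simp add: heat_conv'_diff[OF f g])
      finally show ?thesis by simp
    qed
    also have "\<dots> \<le> integral {0..\<theta>} (\<lambda>s. A * s powr (-3/4))"
    proof (rule integral_norm_bound_integral[OF heat_conv'_integrable_on[OF h]])
      show "(\<lambda>s. A * s powr (-3/4)) integrable_on {0..\<theta>}"
        using has_integral_mult_right[OF has_integral_powr[of \<theta>], of A] \<theta> by (auto simp: integrable_on_def)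
      fix s assume s: "s \<in> {0..\<theta>}"
      show "norm (- heat_conv' ?h s 0) \<le> A * s powr (-3/4)"
      proof (cases "s = 0")
        case False
        then show ?thesis using C(2)[OF h, of s \<kappa> 0] s \<theta> k by (simp add: weight_def A_def mult.commute)
      qed simp
    qed
    also have "\<dots> = A * (4 * \<theta> powr (1/4))"
      using has_integral_mult_right[OF has_integral_powr[of \<theta>], of A] \<theta> by (intro integral_unique) auto
    also have "\<dots> \<le> ((C + 1) * (\<kappa> + wnorm2 ?h / \<kappa>)) * (4 * L powr (1/4))"
      using A \<theta> by (intro mult_mono powr_mono2) auto
    finally show "\<bar>vel_int f \<theta> - vel_int g \<theta>\<bar> \<le> (C + 1) * (4 * L powr (1/4)) * (\<kappa> + wnorm2 ?h / \<kappa>)"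
      by (simp add: mult_ac)
  qed
qed

lemma has_integral_interior:
  fixes Y :: "real \<Rightarrow> real"
  assumes "0 \<le> \<tau>" "continuous_on {0..\<tau>} Y"
    and "\<And>s. 0 < s \<Longrightarrow> s < \<tau> \<Longrightarrow> (Y has_real_derivative D s) (at s)"
  shows "((\<lambda>s. if 0 < s \<and> s < \<tau> then D s else E s) has_integral Y \<tau> - Y 0) {0..\<tau>}"
  using assms by (intro fundamental_theorem_of_calculus_interior)
    (auto simp: has_real_derivative_iff_has_vector_derivative)

text \<open>The two bounds on the velocity are used on different time scales: the one by
  \<open>s powr (- 3 / 4)\<close>, integrable at \<open>0\<close>, on a short initial interval, and the Lipschitz bound on the rest.\<close>

lemma ode_close:
  assumes L: "0 < L" and R: "0 \<le> R" and \<eta>: "0 < \<eta>"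
  obtains \<epsilon>0 where "0 < \<epsilon>0"
    "\<And>\<epsilon> f Y \<theta>. \<lbrakk>0 < \<epsilon>; \<epsilon> < \<epsilon>0; tame f; wnorm2 f \<le> R; continuous_on {0..L} Y; Y 0 = 0;
      \<forall>s. 0 < s \<and> s < L \<longrightarrow> (Y has_real_derivative - heat_conv' f s (\<epsilon> * Y s)) (at s); \<theta> \<in> {0..L}\<rbrakk>
     \<Longrightarrow> \<bar>Y \<theta> - vel_int f \<theta>\<bar> \<le> \<eta>"
proof -
  obtain C where C: "0 < C" "\<And>f s x \<kappa>. tame f \<Longrightarrow> 0 < s \<Longrightarrow> s \<le> L \<Longrightarrow> 0 < \<kappa> \<Longrightarrow>
     \<bar>heat_conv' f s x\<bar> \<le> weight x * s powr (-3/4) * (C * \<kappa> + wnorm2 f / \<kappa>)"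
    by (rule heat_conv'_bound[OF L]) (rule that)
  define A where "A = 2 * (C + R)"
  have A: "0 < A" using C(1) R by (simp add: A_def)
  define \<delta> where "\<delta> = min L ((\<eta> / (16 * A)) powr 4)"
  have \<delta>: "0 < \<delta>" "\<delta> \<le> L" using L \<eta> A by (auto simp: \<delta>_def)
  have \<delta>': "8 * A * \<delta> powr (1/4) \<le> \<eta> / 2"
  proof -
    have "\<delta> powr (1/4) \<le> ((\<eta> / (16 * A)) powr 4) powr (1/4)"
      using \<delta> by (intro powr_mono2) (auto simp: \<delta>_def)
    also have "\<dots> = (\<eta> / (16 * A)) powr 1" unfolding powr_powr by simp
    also have "\<dots> = \<eta> / (16 * A)" using \<eta> A by simp
    finally show ?thesis using A by (simp add: field_simps)
  qed
  obtain C2 where C2: "0 < C2" "\<And>f s x. tame f \<Longrightarrow> \<delta> \<le> s \<Longrightarrow> s \<le> L \<Longrightarrow> \<bar>x\<bar> \<le> 1 \<Longrightarrow>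
     \<bar>heat_conv' f s x - heat_conv' f s 0\<bar> \<le> C2 * (1 + wnorm2 f) * \<bar>x\<bar>"
    by (rule heat_conv'_lipschitz[OF \<delta>]) (rule that)
  define Q where "Q = 4 * A * L powr (1/4)"
  have Q: "0 < Q" using A L by (simp add: Q_def)
  define P where "P = C2 * (1 + R) * Q * L"
  have P: "0 < P" using C2 R Q L by (simp add: P_def)
  show ?thesis
  proof (rule that[of "min (1 / Q) (\<eta> / (2 * P))"])
    show "0 < min (1 / Q) (\<eta> / (2 * P))" using Q P \<eta> by simp
    fix \<epsilon> f Y \<theta>
    assume \<epsilon>: "0 < \<epsilon>" "\<epsilon> < min (1 / Q) (\<eta> / (2 * P))" and f: "tame f" "wnorm2 f \<le> R"
      and Y: "continuous_on {0..L} Y" "Y 0 = 0"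
      and ode: "\<forall>s. 0 < s \<and> s < L \<longrightarrow> (Y has_real_derivative - heat_conv' f s (\<epsilon> * Y s)) (at s)"
      and \<theta>: "\<theta> \<in> {0..L}"
    have Y': "(Y has_real_derivative - heat_conv' f s (\<epsilon> * Y s)) (at s)" if "0 < s" "s < L" for s
      using ode that by blast
    have \<epsilon>Q: "\<epsilon> * Q < 1" and \<epsilon>P: "\<epsilon> * P \<le> \<eta> / 2" using \<epsilon> Q P by (auto simp: field_simps)
    have G: "\<bar>heat_conv' f s x\<bar> \<le> A * s powr (-3/4)" if s: "0 < s" "s \<le> L" and x: "\<bar>x\<bar> \<le> 1" for s x
    proof -
      have w: "weight x \<le> 2" using x by (simp add: weight_def abs_square_le_1)
      have "\<bar>heat_conv' f s x\<bar> \<le> weight x * s powr (-3/4) * (C + wnorm2 f)"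
        using C(2)[OF f(1) s, of 1 x] by simp
      also have "\<dots> \<le> 2 * s powr (-3/4) * (C + R)"
        using w f(2) C(1) by (intro mult_mono) auto
      finally show ?thesis by (simp add: A_def algebra_simps)
    qed
    have apriori: "\<bar>Y \<tau>\<bar> \<le> Q" if \<tau>: "\<tau> \<in> {0..L}" and small: "\<And>s. 0 < s \<Longrightarrow> s < \<tau> \<Longrightarrow> \<bar>\<epsilon> * Y s\<bar> \<le> 1" for \<tau>
    proof -
      have I: "((\<lambda>s. if 0 < s \<and> s < \<tau> then - heat_conv' f s (\<epsilon> * Y s) else 0) has_integral Y \<tau> - Y 0) {0..\<tau>}"
        by (rule has_integral_interior) (use \<tau> in \<open>auto intro!: Y' continuous_on_subset[OF Y(1)]\<close>)
      have J: "((\<lambda>s. A * s powr (-3/4)) has_integral A * (4 * \<tau> powr (1/4))) {0..\<tau>}"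
        using has_integral_powr[of \<tau>] \<tau> by (intro has_integral_mult_right) auto
      have "norm (integral {0..\<tau>} (\<lambda>s. if 0 < s \<and> s < \<tau> then - heat_conv' f s (\<epsilon> * Y s) else 0))
          \<le> integral {0..\<tau>} (\<lambda>s. A * s powr (-3/4))"
      proof (rule integral_norm_bound_integral)
        fix s assume "s \<in> {0..\<tau>}"
        then show "norm (if 0 < s \<and> s < \<tau> then - heat_conv' f s (\<epsilon> * Y s) else 0) \<le> A * s powr (-3/4)"
          using G[of s "\<epsilon> * Y s"] small[of s] \<tau> A by auto
      qed (use I J in auto)
      also have "\<dots> = A * (4 * \<tau> powr (1/4))" using J by (rule integral_unique)
      also have "\<dots> \<le> A * (4 * L powr (1/4))" using A \<tau> by (intro mult_left_mono powr_mono2) auto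
      finally show ?thesis using integral_unique[OF I] Y(2) by (simp add: Q_def)
    qed
    have small: "\<bar>\<epsilon> * Y s\<bar> < 1" if s: "s \<in> {0..L}" for s
    proof (rule ccontr)
      assume *: "\<not> \<bar>\<epsilon> * Y s\<bar> < 1"
      define S where "S = {0..L} \<inter> (\<lambda>s. \<bar>\<epsilon> * Y s\<bar>) -` {1..}"
      have cl: "closed S" unfolding S_def
        by (rule continuous_closed_preimage) (auto intro!: continuous_intros Y)
      have ne: "S \<noteq> {}" using s * by (auto simp: S_def)
      have bb: "bdd_below S" by (rule bdd_belowI[of _ 0]) (auto simp: S_def)
      have in_S: "Inf S \<in> S" by (rule closed_contains_Inf[OF ne bb cl])
      have "\<bar>Y (Inf S)\<bar> \<le> Q"
      proof (rule apriori)
        show "Inf S \<in> {0..L}" using in_S by (simp add: S_def)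
        fix r assume r: "0 < r" "r < Inf S"
        have "r \<notin> S" using r(2) cInf_lower[OF _ bb, of r] by auto
        then show "\<bar>\<epsilon> * Y r\<bar> \<le> 1" using r in_S by (auto simp: S_def)
      qed
      then have "\<bar>\<epsilon> * Y (Inf S)\<bar> \<le> \<epsilon> * Q" using \<epsilon>(1) by (simp add: abs_mult)
      moreover have "1 \<le> \<bar>\<epsilon> * Y (Inf S)\<bar>" using in_S by (simp add: S_def)
      ultimately show False using \<epsilon>Q by linarith
    qed
    have YQ: "\<bar>Y s\<bar> \<le> Q" if "s \<in> {0..L}" for s
      using that by (intro apriori less_imp_le[OF small]) auto
    define E where "E = \<epsilon> * (C2 * (1 + R) * Q)"
    have E: "0 \<le> E" using \<epsilon>(1) C2(1) R Q by (simp add: E_def)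
    let ?h = "\<lambda>s. (if s \<in> {0..\<delta>} then 2 * A * s powr (-3/4) else 0) + E"
    have sub: "{0..\<delta>} \<subseteq> {0..L}" using \<delta> by auto
    have h: "(?h has_integral 2 * A * (4 * \<delta> powr (1/4)) + (L - 0) * E) {0..L}"
    proof (rule has_integral_add)
      show "((\<lambda>s. if s \<in> {0..\<delta>} then 2 * A * s powr (-3/4) else 0) has_integral 2 * A * (4 * \<delta> powr (1/4))) {0..L}"
        unfolding has_integral_restrict[OF sub] by (rule has_integral_mult_right[OF has_integral_powr]) (use \<delta> in simp)
      show "((\<lambda>s. E) has_integral (L - 0) * E) {0..L}"
        using has_integral_const_real[of E 0 L] L by simp
    qed
    have hpos: "0 \<le> ?h s" for s using A E by auto
    let ?D = "\<lambda>s. if 0 < s \<and> s < \<theta> then - heat_conv' f s (\<epsilon> * Y s) else - heat_conv' f s 0"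
    have I: "(?D has_integral Y \<theta> - Y 0) {0..\<theta>}"
      by (rule has_integral_interior) (use \<theta> in \<open>auto intro!: Y' continuous_on_subset[OF Y(1)]\<close>)
    have h': "?h integrable_on {0..\<theta>}"
      by (rule integrable_subinterval_real[of _ 0 L]) (use h \<theta> in auto)
    have eq: "Y \<theta> - vel_int f \<theta> = integral {0..\<theta>} (\<lambda>s. ?D s - - heat_conv' f s 0)"
      using integral_diff[OF has_integral_integrable[OF I] heat_conv'_integrable_on[OF f(1)]] integral_unique[OF I] Y(2)
      by (simp add: vel_int_def)
    have "\<bar>Y \<theta> - vel_int f \<theta>\<bar> \<le> integral {0..\<theta>} ?h"
      unfolding eq real_norm_def[symmetric]
    proof (rule integral_norm_bound_integral[OF integrable_diff[OF has_integral_integrable[OF I] heat_conv'_integrable_on[OF f(1)]] h'])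
      fix s assume s: "s \<in> {0..\<theta>}"
      show "norm (?D s - - heat_conv' f s 0) \<le> ?h s"
      proof (cases "0 < s \<and> s < \<theta>")
        case True
        then have sL: "0 < s" "s \<le> L" "s \<in> {0..L}" using \<theta> by auto
        show ?thesis
        proof (cases "s \<le> \<delta>")
          case d: True
          have "\<bar>heat_conv' f s (\<epsilon> * Y s)\<bar> \<le> A * s powr (-3/4)" "\<bar>heat_conv' f s 0\<bar> \<le> A * s powr (-3/4)"
            using small[OF sL(3)] by (intro G sL; simp)+
          then show ?thesis using True d E by simp
        next
          case d: False
          have "\<bar>heat_conv' f s (\<epsilon> * Y s) - heat_conv' f s 0\<bar> \<le> C2 * (1 + wnorm2 f) * \<bar>\<epsilon> * Y s\<bar>"
            using small[OF sL(3)] d sL by (intro C2(2) f) auto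
          also have "\<dots> \<le> C2 * (1 + R) * (\<epsilon> * Q)"
            using C2(1) f(2) \<epsilon>(1) YQ[OF sL(3)] R by (intro mult_mono) (auto simp: abs_mult)
          finally show ?thesis using True d by (simp add: E_def mult_ac)
        qed
      qed (use E A in auto)
    qed
    also have "\<dots> \<le> integral {0..L} ?h"
      by (rule integral_subset_le) (use \<theta> h h' E A in auto)
    also have "\<dots> = 2 * A * (4 * \<delta> powr (1/4)) + (L - 0) * E" using h by (rule integral_unique)
    also have "\<dots> = 8 * A * \<delta> powr (1/4) + \<epsilon> * P" by (simp add: E_def P_def)
    also have "\<dots> \<le> \<eta>" using \<delta>' \<epsilon>P by linarith
    finally show "\<bar>Y \<theta> - vel_int f \<theta>\<bar> \<le> \<eta>" .
  qed
qed

section \<open>Brownian paths\<close>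

definition grid_index :: "nat \<Rightarrow> real \<Rightarrow> nat" where
  "grid_index n y = (if \<bar>y\<bar> < real n then nat (\<lfloor>real n * y\<rfloor> + int (n * n)) else n * n)"

definition grid_point :: "nat \<Rightarrow> nat \<Rightarrow> real" where
  "grid_point n i = (real i - real (n * n)) / real n"

definition grid :: "nat \<Rightarrow> real \<Rightarrow> real" where
  "grid n y = grid_point n (grid_index n y)"

lemma grid_index_le: "grid_index n y \<le> 2 * (n * n)"
proof (cases "\<bar>y\<bar> < real n")
  case True
  then have "real n * y \<le> real n * real n" by (intro mult_left_mono) auto
  then have "\<lfloor>real n * y\<rfloor> \<le> int (n * n)" by (simp add: floor_le_iff)
  then show ?thesis using True by (simp add: grid_index_def nat_le_iff)
qed (simp add: grid_index_def)

lemma grid_eq: "grid n y = (if \<bar>y\<bar> < real n then real_of_int \<lfloor>real n * y\<rfloor> / real n else 0)"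
proof (cases "\<bar>y\<bar> < real n")
  case True
  then have "real n * (- real n) \<le> real n * y" by (intro mult_left_mono) auto
  then have "- int (n * n) \<le> \<lfloor>real n * y\<rfloor>" by (simp add: le_floor_iff)
  then have "real (nat (\<lfloor>real n * y\<rfloor> + int (n * n))) = real_of_int \<lfloor>real n * y\<rfloor> + real (n * n)" by simp
  then show ?thesis using True by (simp only: grid_def grid_point_def grid_index_def if_True) simp
qed (simp add: grid_def grid_point_def grid_index_def)

lemma grid_index_measurable [measurable]: "grid_index n \<in> borel \<rightarrow>\<^sub>M count_space UNIV"
  unfolding grid_index_def by measurable

lemma grid_measurable [measurable]: "grid n \<in> borel_measurable borel"
  unfolding grid_def[abs_def] by measurable

lemma grid_close: "\<bar>y - grid n y\<bar> \<le> 1 + \<bar>y\<bar>"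
proof (cases "\<bar>y\<bar> < real n")
  case True
  then have n: "1 \<le> real n" by (cases n) auto
  have "\<bar>real n * y - real_of_int \<lfloor>real n * y\<rfloor>\<bar> \<le> 1" by linarith
  then have "\<bar>real n * y - real_of_int \<lfloor>real n * y\<rfloor>\<bar> / real n \<le> 1 / real n" by (rule divide_right_mono) simp
  also have "\<bar>real n * y - real_of_int \<lfloor>real n * y\<rfloor>\<bar> / real n = \<bar>(real n * y - real_of_int \<lfloor>real n * y\<rfloor>) / real n\<bar>"
    by simp
  also have "(real n * y - real_of_int \<lfloor>real n * y\<rfloor>) / real n = y - real_of_int \<lfloor>real n * y\<rfloor> / real n"
    using n by (simp add: field_simps)
  also have "1 / real n \<le> 1" using n by simp
  finally show ?thesis using True by (simp add: grid_eq)
qed (simp add: grid_eq)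

lemma grid_tendsto: "(\<lambda>n. grid n y) \<longlonglongrightarrow> y"
proof -
  obtain n0 :: nat where "\<bar>y\<bar> < real n0" using reals_Archimedean2 by blast
  then have "\<forall>\<^sub>F n in sequentially. real_of_int \<lfloor>real n * y\<rfloor> / real n = grid n y"
    by (intro eventually_sequentiallyI[of n0]) (simp add: grid_eq)
  then show ?thesis by (rule Lim_transform_eventually[OF floor_grid_tendsto])
qed

lemma integrable_abs_weight: "integrable lborel (\<lambda>y. (1 + \<bar>y\<bar>) / (weight y)\<^sup>2)"
proof (rule integrable_bound_weight[where C=2])
  fix y :: real
  have "0 \<le> (\<bar>y\<bar> - 1)\<^sup>2" by simp
  then have "2 * \<bar>y\<bar> \<le> 1 + y\<^sup>2" by (simp add: power2_eq_square algebra_simps)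
  then have "1 + \<bar>y\<bar> \<le> 2 * weight y" using zero_le_power2[of y] unfolding weight_def by (smt (verit))
  then have "(1 + \<bar>y\<bar>) / (weight y)\<^sup>2 \<le> 2 * weight y / (weight y)\<^sup>2" by (rule divide_right_mono) simp
  then show "\<bar>(1 + \<bar>y\<bar>) / (weight y)\<^sup>2\<bar> \<le> 2 / weight y" by (simp add: power2_eq_square)
qed measurable

definition grid_error :: "nat \<Rightarrow> real" where
  "grid_error n = (\<integral>y. \<bar>y - grid n y\<bar> / (weight y)\<^sup>2 \<partial>lborel)"

lemma integrable_dist_weight:
  assumes [measurable]: "d \<in> borel_measurable borel" and "\<And>y. \<bar>y - d y\<bar> \<le> 1 + \<bar>y\<bar>"
  shows "integrable lborel (\<lambda>y. \<bar>y - d y\<bar> / (weight y)\<^sup>2)"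
  by (rule Bochner_Integration.integrable_bound[OF integrable_abs_weight])
     (auto intro!: AE_I2 divide_right_mono assms)

lemma grid_error_tendsto: "grid_error \<longlonglongrightarrow> 0"
proof -
  have "(\<lambda>n. \<integral>y. \<bar>y - grid n y\<bar> / (weight y)\<^sup>2 \<partial>lborel) \<longlonglongrightarrow> (\<integral>y. 0 \<partial>(lborel :: real measure))"
  proof (rule integral_dominated_convergence[OF _ _ integrable_abs_weight])
    have "(\<lambda>n. \<bar>y - grid n y\<bar> / (weight y)\<^sup>2) \<longlonglongrightarrow> \<bar>y - y\<bar> / (weight y)\<^sup>2" for y
      by (intro tendsto_intros grid_tendsto) simp
    then show "AE y in lborel. (\<lambda>n. \<bar>y - grid n y\<bar> / (weight y)\<^sup>2) \<longlonglongrightarrow> 0" by simp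
    show "AE y in lborel. norm (\<bar>y - grid n y\<bar> / (weight y)\<^sup>2) \<le> (1 + \<bar>y\<bar>) / (weight y)\<^sup>2" for n
      by (intro AE_I2) (simp add: divide_right_mono grid_close)
  qed measurable
  then show ?thesis by (simp add: grid_error_def[abs_def])
qed

lemma continuous_process_measurable:
  fixes B :: "real \<Rightarrow> 'a \<Rightarrow> real"
  assumes B: "\<And>x. B x \<in> borel_measurable M" and cont: "\<And>\<omega>. continuous_on UNIV (\<lambda>x. B x \<omega>)"
  shows "(\<lambda>p. B (snd p) (fst p)) \<in> borel_measurable (M \<Otimes>\<^sub>M borel)"
proof (rule borel_measurable_LIMSEQ_real)
  fix p :: "'a \<times> real"
  show "(\<lambda>n. B (real_of_int \<lfloor>real n * snd p\<rfloor> / real n) (fst p)) \<longlonglongrightarrow> B (snd p) (fst p)"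
    by (rule continuous_on_tendsto_compose[OF cont floor_grid_tendsto]) auto
next
  fix n
  have [measurable]: "B x \<in> borel_measurable M" for x by (rule B)
  show "(\<lambda>p. B (real_of_int \<lfloor>real n * snd p\<rfloor> / real n) (fst p)) \<in> borel_measurable (M \<Otimes>\<^sub>M borel)"
    by (rule measurable_compose_countable[where f="\<lambda>i p. B (real_of_int i / real n) (fst p)" and g="\<lambda>p. \<lfloor>real n * snd p\<rfloor>"])
       measurable
qed

locale brownian_path = prob_space M for M :: "'a measure" +
  fixes B :: "real \<Rightarrow> 'a \<Rightarrow> real"
  assumes brownian: "brownian_motion M B"
    and path_continuous: "\<And>\<omega>. continuous_on UNIV (\<lambda>x. B x \<omega>)"
    and path_0: "\<And>\<omega>. B 0 \<omega> = 0"
begin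

lemma path_measurable [measurable]: "B x \<in> borel_measurable M"
  using brownian by (simp add: brownian_motion_def)

lemma path_measurable_joint [measurable (raw)]:
  assumes [measurable]: "f \<in> N \<rightarrow>\<^sub>M M" "g \<in> borel_measurable N"
  shows "(\<lambda>x. B (g x) (f x)) \<in> borel_measurable N"
  using measurable_compose[of "\<lambda>x. (f x, g x)" N "M \<Otimes>\<^sub>M borel", OF _ continuous_process_measurable[OF path_measurable path_continuous]]
  by simp

lemma path_borel [measurable]: "(\<lambda>y. B y \<omega>) \<in> borel_measurable borel"
  by (rule borel_measurable_continuous_onI[OF path_continuous])

lemma second_moment: "(\<integral>\<^sup>+\<omega>. ennreal ((B y \<omega> - B x \<omega>)\<^sup>2) \<partial>M) = ennreal \<bar>y - x\<bar>"
proof -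
  have *: "(\<integral>\<^sup>+\<omega>. ennreal ((B y \<omega> - B x \<omega>)\<^sup>2) \<partial>M) = ennreal (y - x)" if "x < y" for x y
  proof -
    have D: "distributed M lborel (\<lambda>\<omega>. B y \<omega> - B x \<omega>) (normal_density 0 (sqrt (y - x)))"
      using brownian that by (simp add: brownian_motion_def)
    have N: "has_bochner_integral lborel (\<lambda>z. normal_density 0 (sqrt (y - x)) z * z\<^sup>2) (y - x)"
      using normal_moment_even[of "sqrt (y - x)" 0 1] that by (simp add: fact_2 diff_divide_distrib)
    have "(\<integral>\<^sup>+\<omega>. ennreal ((B y \<omega> - B x \<omega>)\<^sup>2) \<partial>M)
        = (\<integral>\<^sup>+z. ennreal (normal_density 0 (sqrt (y - x)) z) * ennreal (z\<^sup>2) \<partial>lborel)"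
      using distributed_nn_integral[OF D, of "\<lambda>z. ennreal (z\<^sup>2)"] by simp
    also have "\<dots> = (\<integral>\<^sup>+z. ennreal (normal_density 0 (sqrt (y - x)) z * z\<^sup>2) \<partial>lborel)"
      by (simp add: ennreal_mult)
    also have "\<dots> = ennreal (\<integral>z. normal_density 0 (sqrt (y - x)) z * z\<^sup>2 \<partial>lborel)"
      using N by (intro nn_integral_eq_integral) (auto simp: has_bochner_integral_iff)
    finally show ?thesis using N by (simp add: has_bochner_integral_iff)
  qed
  show ?thesis
  proof (cases x y rule: linorder_cases)
    case less then show ?thesis using *[of x y] by simp
  next
    case greater then show ?thesis using *[of y x] by (simp add: power2_commute[of "B y _"])
  qed simp
qed

lemma expected_weighted_square:
  assumes [measurable]: "d \<in> borel_measurable borel" and d: "\<And>y. \<bar>y - d y\<bar> \<le> 1 + \<bar>y\<bar>"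
  shows "(\<integral>\<^sup>+\<omega>. \<integral>\<^sup>+y. ennreal ((B y \<omega> - B (d y) \<omega>)\<^sup>2 / (weight y)\<^sup>2) \<partial>lborel \<partial>M)
      = ennreal (\<integral>y. \<bar>y - d y\<bar> / (weight y)\<^sup>2 \<partial>lborel)"
proof -
  interpret pair_sigma_finite lborel M ..
  have "(\<integral>\<^sup>+\<omega>. \<integral>\<^sup>+y. ennreal ((B y \<omega> - B (d y) \<omega>)\<^sup>2 / (weight y)\<^sup>2) \<partial>lborel \<partial>M)
      = (\<integral>\<^sup>+y. \<integral>\<^sup>+\<omega>. ennreal ((B y \<omega> - B (d y) \<omega>)\<^sup>2 / (weight y)\<^sup>2) \<partial>M \<partial>lborel)"
    by (rule Fubini') measurable
  also have "\<dots> = (\<integral>\<^sup>+y. ennreal (\<bar>y - d y\<bar> / (weight y)\<^sup>2) \<partial>lborel)"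
  proof (rule nn_integral_cong)
    fix y
    have "(\<integral>\<^sup>+\<omega>. ennreal ((B y \<omega> - B (d y) \<omega>)\<^sup>2 / (weight y)\<^sup>2) \<partial>M)
        = (\<integral>\<^sup>+\<omega>. ennreal (1 / (weight y)\<^sup>2) * ennreal ((B y \<omega> - B (d y) \<omega>)\<^sup>2) \<partial>M)"
      by (simp add: ennreal_mult[symmetric])
    also have "\<dots> = ennreal (1 / (weight y)\<^sup>2) * ennreal \<bar>y - d y\<bar>"
      by (simp add: nn_integral_cmult second_moment)
    finally show "(\<integral>\<^sup>+\<omega>. ennreal ((B y \<omega> - B (d y) \<omega>)\<^sup>2 / (weight y)\<^sup>2) \<partial>M) = ennreal (\<bar>y - d y\<bar> / (weight y)\<^sup>2)"
      by (simp add: ennreal_mult[symmetric])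
  qed
  also have "\<dots> = ennreal (\<integral>y. \<bar>y - d y\<bar> / (weight y)\<^sup>2 \<partial>lborel)"
    by (rule nn_integral_eq_integral[OF integrable_dist_weight[OF assms]]) simp
  finally show ?thesis .
qed

lemma AE_tame: "AE \<omega> in M. tame (\<lambda>y. B y \<omega>)"
proof -
  have "(\<integral>\<^sup>+\<omega>. \<integral>\<^sup>+y. ennreal ((B y \<omega>)\<^sup>2 / (weight y)\<^sup>2) \<partial>lborel \<partial>M) \<noteq> \<infinity>"
    using expected_weighted_square[of "\<lambda>_. 0"] by (simp add: path_0)
  then have "AE \<omega> in M. (\<integral>\<^sup>+y. ennreal ((B y \<omega>)\<^sup>2 / (weight y)\<^sup>2) \<partial>lborel) \<noteq> \<infinity>"
    by (rule nn_integral_PInf_AE[rotated]) measurable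
  then show ?thesis
    by (rule AE_mp) (auto intro!: AE_I2 simp: tame_def integrable_iff_bounded top.not_eq_extremum)
qed

end

locale tame_brownian = brownian_path +
  assumes path_tame: "\<And>\<omega>. tame (\<lambda>y. B y \<omega>)"
begin

lemma wnorm2_measurable [measurable]: "(\<lambda>\<omega>. wnorm2 (\<lambda>y. B y \<omega>)) \<in> borel_measurable M"
  unfolding wnorm2_def by measurable

lemma expectation_wnorm2:
  assumes [measurable]: "d \<in> borel_measurable borel" and d: "\<And>y. \<bar>y - d y\<bar> \<le> 1 + \<bar>y\<bar>"
    and t: "\<And>\<omega>. tame (\<lambda>y. B (d y) \<omega>)"
  shows "has_bochner_integral M (\<lambda>\<omega>. wnorm2 (\<lambda>y. B y \<omega> - B (d y) \<omega>)) (\<integral>y. \<bar>y - d y\<bar> / (weight y)\<^sup>2 \<partial>lborel)"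
proof (rule has_bochner_integral_nn_integral)
  show "(\<lambda>\<omega>. wnorm2 (\<lambda>y. B y \<omega> - B (d y) \<omega>)) \<in> borel_measurable M"
    unfolding wnorm2_def by measurable
  show "0 \<le> (\<integral>y. \<bar>y - d y\<bar> / (weight y)\<^sup>2 \<partial>lborel)" by (intro integral_nonneg_AE AE_I2) simp
  have "ennreal (wnorm2 (\<lambda>y. B y \<omega> - B (d y) \<omega>)) = (\<integral>\<^sup>+y. ennreal ((B y \<omega> - B (d y) \<omega>)\<^sup>2 / (weight y)\<^sup>2) \<partial>lborel)" for \<omega>
    unfolding wnorm2_def using tame_diff[OF path_tame t]
    by (intro nn_integral_eq_integral[symmetric]) (auto simp: tame_def)
  then show "(\<integral>\<^sup>+\<omega>. ennreal (wnorm2 (\<lambda>y. B y \<omega> - B (d y) \<omega>)) \<partial>M) = ennreal (\<integral>y. \<bar>y - d y\<bar> / (weight y)\<^sup>2 \<partial>lborel)"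
    using expected_weighted_square[OF assms(1) d] by simp
qed simp

lemma prob_wnorm2_ge:
  assumes "0 < c"
  shows "prob {\<omega> \<in> space M. c \<le> wnorm2 (\<lambda>y. B y \<omega>)} \<le> (\<integral>y. \<bar>y\<bar> / (weight y)\<^sup>2 \<partial>lborel) / c"
proof -
  have "has_bochner_integral M (\<lambda>\<omega>. wnorm2 (\<lambda>y. B y \<omega> - B 0 \<omega>)) (\<integral>y. \<bar>y - 0\<bar> / (weight y)\<^sup>2 \<partial>lborel)"
    by (rule expectation_wnorm2) (auto simp: path_0 tame_def)
  then have *: "integrable M (\<lambda>\<omega>. wnorm2 (\<lambda>y. B y \<omega>))"
      "expectation (\<lambda>\<omega>. wnorm2 (\<lambda>y. B y \<omega>)) = (\<integral>y. \<bar>y\<bar> / (weight y)\<^sup>2 \<partial>lborel)"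
    by (auto simp: has_bochner_integral_iff path_0)
  show ?thesis using integral_Markov_inequality_measure[OF *(1) sets.top _ assms] *(2) by simp
qed

end

lemma tame_bounded:
  assumes [measurable]: "f \<in> borel_measurable borel" and b: "\<And>y. \<bar>f y\<bar> \<le> c"
  shows "tame f"
proof -
  have "integrable lborel (\<lambda>y. (f y)\<^sup>2 / (weight y)\<^sup>2)"
  proof (rule Bochner_Integration.integrable_bound[OF integrable_mult_right[OF integrable_inverse_weight2, of "c\<^sup>2"]])
    have "(f y)\<^sup>2 \<le> c\<^sup>2" for y using power_mono[OF b[of y], of 2] by simp
    then show "AE y in lborel. norm ((f y)\<^sup>2 / (weight y)\<^sup>2) \<le> norm (c\<^sup>2 * (1 / (weight y)\<^sup>2))"
      by (intro AE_I2) (simp add: divide_right_mono)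
  qed measurable
  then show ?thesis by (simp add: tame_def)
qed

lemma tame_grid: "tame (\<lambda>y. c (grid_index n y))"
proof (rule tame_bounded)
  show "\<bar>c (grid_index n y)\<bar> \<le> (\<Sum>i\<le>2 * (n * n). \<bar>c i\<bar>)" for y
    using grid_index_le[of n y] by (intro member_le_sum) auto
  show "(\<lambda>y. c (grid_index n y)) \<in> borel_measurable borel"
    by (rule measurable_compose[OF grid_index_measurable]) simp
qed

lemma heat_conv'_sum:
  assumes "\<And>i. i \<in> I \<Longrightarrow> tame (h i)" "0 \<le> s"
  shows "heat_conv' (\<lambda>y. \<Sum>i\<in>I. c i * h i y) s x = (\<Sum>i\<in>I. c i * heat_conv' (h i) s x)"
proof (cases "s = 0")
  case False
  then have s: "0 < s" using assms by simp
  have "heat_conv' (\<lambda>y. \<Sum>i\<in>I. c i * h i y) s x = (\<integral>y. (\<Sum>i\<in>I. c i * (heat_kernel' s (x - y) * h i y)) \<partial>lborel)"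
    unfolding heat_conv'_def by (simp add: sum_distrib_left mult_ac)
  also have "\<dots> = (\<Sum>i\<in>I. c i * heat_conv' (h i) s x)"
    unfolding heat_conv'_def
    by (subst Bochner_Integration.integral_sum) (auto intro!: integrable_mult_right heat_conv_integrable(2) assms s)
  finally show ?thesis .
qed simp

lemma vel_int_sum:
  assumes "finite I" "\<And>i. i \<in> I \<Longrightarrow> tame (h i)"
  shows "vel_int (\<lambda>y. \<Sum>i\<in>I. c i * h i y) \<theta> = (\<Sum>i\<in>I. c i * vel_int (h i) \<theta>)"
proof -
  have i: "(\<lambda>s. c i * - heat_conv' (h i) s 0) integrable_on {0..\<theta>}" if "i \<in> I" for i
    by (rule integrable_on_mult_right[OF heat_conv'_integrable_on[OF assms(2)[OF that]]])
  have "vel_int (\<lambda>y. \<Sum>i\<in>I. c i * h i y) \<theta> = integral {0..\<theta>} (\<lambda>s. \<Sum>i\<in>I. c i * - heat_conv' (h i) s 0)"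
    unfolding vel_int_def by (rule integral_cong) (simp add: heat_conv'_sum assms sum_negf)
  also have "\<dots> = (\<Sum>i\<in>I. integral {0..\<theta>} (\<lambda>s. c i * - heat_conv' (h i) s 0))"
    by (rule integral_sum[OF assms(1) i])
  also have "\<dots> = (\<Sum>i\<in>I. c i * vel_int (h i) \<theta>)"
    unfolding vel_int_def by (simp only: integral_mult_right)
  finally show ?thesis .
qed

definition vel_path :: "(real \<Rightarrow> real) \<Rightarrow> real \<Rightarrow> real" where
  "vel_path f = restrict (vel_int f) {0..}"

lemma vel_path_in: "tame f \<Longrightarrow> vel_path f \<in> cont_fun_space"
  unfolding vel_path_def by (rule restrict_in_cont_fun_space[OF vel_int_continuous])

lemma vel_path_grid_measurable:
  assumes "\<And>i. i \<le> 2 * (n * n) \<Longrightarrow> (\<lambda>\<omega>. c \<omega> i) \<in> borel_measurable N"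
  shows "(\<lambda>\<omega>. vel_path (\<lambda>y. c \<omega> (grid_index n y))) \<in> N \<rightarrow>\<^sub>M borel_of ucc_topology"
proof (rule measurable_borel_of_uccI)
  show "vel_path (\<lambda>y. c \<omega> (grid_index n y)) \<in> cont_fun_space" for \<omega> by (rule vel_path_in[OF tame_grid])
  fix t :: real assume t: "0 \<le> t"
  let ?h = "\<lambda>i y. indicator {y. grid_index n y = i} y :: real"
  have h: "tame (?h i)" for i
    using tame_grid[of "\<lambda>j. if j = i then 1 else 0" n] by (simp add: indicator_def if_distrib of_bool_def)
  have "c \<omega> (grid_index n y) = (\<Sum>i\<le>2 * (n * n). c \<omega> i * ?h i y)" for \<omega> y
  proof -
    have "(\<Sum>i\<le>2 * (n * n). c \<omega> i * ?h i y) = (\<Sum>i\<le>2 * (n * n). if i = grid_index n y then c \<omega> i else 0)"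
      by (rule sum.cong) (auto simp: indicator_def)
    then show ?thesis using grid_index_le[of n y] by simp
  qed
  then have "vel_path (\<lambda>y. c \<omega> (grid_index n y)) t = (\<Sum>i\<le>2 * (n * n). c \<omega> i * vel_int (?h i) t)" for \<omega>
    using vel_int_sum[of "{..2 * (n * n)}" ?h "c \<omega>" t] h t by (simp add: vel_path_def)
  then show "(\<lambda>\<omega>. vel_path (\<lambda>y. c \<omega> (grid_index n y)) t) \<in> borel_measurable N"
    using assms by simp
qed

context brownian_path
begin

lemma increments_distr:
  assumes "0 < N" and x: "strict_mono_on {..N} x"
  shows "distr M (Pi\<^sub>M {..<N} (\<lambda>_. borel)) (\<lambda>\<omega>. \<lambda>j\<in>{..<N}. B (x (Suc j)) \<omega> - B (x j) \<omega>)
       = Pi\<^sub>M {..<N} (\<lambda>j. density lborel (normal_density 0 (sqrt (x (Suc j) - x j))))"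
proof -
  have "indep_vars (\<lambda>_. borel) (\<lambda>j \<omega>. B (x (Suc j)) \<omega> - B (x j) \<omega>) {..<N}"
    using brownian x by (simp add: brownian_motion_def)
  then have "distr M (Pi\<^sub>M {..<N} (\<lambda>_. borel)) (\<lambda>\<omega>. \<lambda>j\<in>{..<N}. B (x (Suc j)) \<omega> - B (x j) \<omega>)
       = Pi\<^sub>M {..<N} (\<lambda>j. distr M borel (\<lambda>\<omega>. B (x (Suc j)) \<omega> - B (x j) \<omega>))"
    using assms(1) by (subst indep_vars_iff_distr_eq_PiM[symmetric]) auto
  also have "\<dots> = Pi\<^sub>M {..<N} (\<lambda>j. density lborel (normal_density 0 (sqrt (x (Suc j) - x j))))"
  proof (rule PiM_cong[OF refl])
    fix j assume "j \<in> {..<N}"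
    then have "x j < x (Suc j)" using x by (auto intro!: strict_mono_onD[OF x])
    then have "distributed M lborel (\<lambda>\<omega>. B (x (Suc j)) \<omega> - B (x j) \<omega>) (normal_density 0 (sqrt (x (Suc j) - x j)))"
      using brownian by (simp add: brownian_motion_def)
    from distributed_distr_eq_density[OF this]
    show "distr M borel (\<lambda>\<omega>. B (x (Suc j)) \<omega> - B (x j) \<omega>) = density lborel (normal_density 0 (sqrt (x (Suc j) - x j)))"
      by (metis (no_types, lifting) distr_cong sets_lborel)
  qed
  finally show ?thesis .
qed

text \<open>The values at the grid points are recovered from the increments because the path is \<open>0\<close> at
  the point with index \<open>n * n\<close>.\<close>

lemma expectation_grid:
  fixes \<psi> :: "(real \<Rightarrow> real) \<Rightarrow> real"
  assumes n: "0 < n" and \<psi>: "\<psi> \<in> borel_measurable (borel_of ucc_topology)"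
  shows "expectation (\<lambda>\<omega>. \<psi> (vel_path (\<lambda>y. B (grid n y) \<omega>))) =
    (\<integral>\<delta>. \<psi> (vel_path (\<lambda>y. (\<Sum>j<grid_index n y. \<delta> j) - (\<Sum>j<n * n. \<delta> j)))
      \<partial>Pi\<^sub>M {..<2 * (n * n)} (\<lambda>j. density lborel (normal_density 0 (sqrt (grid_point n (Suc j) - grid_point n j)))))"
proof -
  let ?N = "2 * (n * n)"
  let ?x = "grid_point n"
  define \<Delta> where "\<Delta> \<omega> = (\<lambda>j\<in>{..<?N}. B (?x (Suc j)) \<omega> - B (?x j) \<omega>)" for \<omega>
  define S where "S \<delta> i = (\<Sum>j<i. \<delta> j) - (\<Sum>j<n * n. \<delta> j)" for \<delta> :: "nat \<Rightarrow> real" and i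
  have sm: "strict_mono_on {..?N} ?x"
    using n by (auto simp: strict_mono_on_def grid_point_def divide_strict_right_mono)
  have tel: "(\<Sum>j<i. \<Delta> \<omega> j) = B (?x i) \<omega> - B (?x 0) \<omega>" if "i \<le> ?N" for i \<omega>
  proof -
    have "(\<Sum>j<i. \<Delta> \<omega> j) = (\<Sum>j<i. B (?x (Suc j)) \<omega> - B (?x j) \<omega>)"
      using that by (intro sum.cong) (auto simp: \<Delta>_def)
    also have "\<dots> = B (?x i) \<omega> - B (?x 0) \<omega>" by (rule sum_lessThan_telescope)
    finally show ?thesis .
  qed
  have x0: "?x (n * n) = 0" by (simp add: grid_point_def)
  have S: "S (\<Delta> \<omega>) i = B (?x i) \<omega>" if "i \<le> ?N" for i \<omega>
    using tel[OF that] tel[of "n * n" \<omega>] by (simp add: S_def x0 path_0)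
  have m: "(\<lambda>\<delta>. \<psi> (vel_path (\<lambda>y. S \<delta> (grid_index n y)))) \<in> borel_measurable (Pi\<^sub>M {..<?N} (\<lambda>_. borel))"
    by (rule measurable_compose[OF vel_path_grid_measurable \<psi>])
       (auto simp: S_def intro!: borel_measurable_diff borel_measurable_sum measurable_component_singleton)
  have \<Delta>: "\<Delta> \<in> M \<rightarrow>\<^sub>M Pi\<^sub>M {..<?N} (\<lambda>_. borel)"
    unfolding \<Delta>_def by (rule measurable_restrict) measurable
  have "expectation (\<lambda>\<omega>. \<psi> (vel_path (\<lambda>y. B (grid n y) \<omega>))) = expectation (\<lambda>\<omega>. \<psi> (vel_path (\<lambda>y. S (\<Delta> \<omega>) (grid_index n y))))"
    by (simp add: S grid_index_le grid_def)
  also have "\<dots> = (\<integral>\<delta>. \<psi> (vel_path (\<lambda>y. S \<delta> (grid_index n y))) \<partial>distr M (Pi\<^sub>M {..<?N} (\<lambda>_. borel)) \<Delta>)"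
    by (rule integral_distr[OF \<Delta> m, symmetric])
  also have "distr M (Pi\<^sub>M {..<?N} (\<lambda>_. borel)) \<Delta> = Pi\<^sub>M {..<?N} (\<lambda>j. density lborel (normal_density 0 (sqrt (?x (Suc j) - ?x j))))"
    unfolding \<Delta>_def[abs_def] by (rule increments_distr[OF _ sm]) (use n in simp)
  finally show ?thesis unfolding S_def .
qed

end

section \<open>Brownian scaling\<close>

definition rescale :: "real \<Rightarrow> (real \<Rightarrow> 'a \<Rightarrow> real) \<Rightarrow> real \<Rightarrow> 'a \<Rightarrow> real" where
  "rescale T B x \<omega> = B (sqrt T * x) \<omega> / T powr (1/4)"

lemma brownian_motion_rescale:
  assumes B: "brownian_motion M B" and T: "0 < T"
  shows "brownian_motion M (rescale T B)"
proof -
  interpret prob_space M using B by (simp add: brownian_motion_def)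
  have [measurable]: "B x \<in> borel_measurable M" for x using B by (simp add: brownian_motion_def)
  have "distributed M lborel (\<lambda>\<omega>. rescale T B y \<omega> - rescale T B x \<omega>) (normal_density 0 (sqrt (y - x)))"
    if xy: "x < y" for x y
  proof -
    let ?\<sigma> = "sqrt (sqrt T * y - sqrt T * x)"
    have lt: "sqrt T * x < sqrt T * y" using xy T by simp
    then have "distributed M lborel (\<lambda>\<omega>. B (sqrt T * y) \<omega> - B (sqrt T * x) \<omega>) (normal_density 0 ?\<sigma>)"
      using B by (simp add: brownian_motion_def)
    from normal_density_affine[OF this, of "1 / T powr (1/4)" 0] lt T
    have "distributed M lborel (\<lambda>\<omega>. rescale T B y \<omega> - rescale T B x \<omega>) (normal_density 0 (\<bar>1 / T powr (1/4)\<bar> * ?\<sigma>))"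
      by (simp add: rescale_def diff_divide_distrib)
    moreover have "\<bar>1 / T powr (1/4)\<bar> * ?\<sigma> = sqrt (y - x)"
    proof -
      have "sqrt (sqrt T) = T powr (1/4)" using T by (simp add: powr_half_sqrt[symmetric] powr_powr)
      moreover have "?\<sigma> = sqrt (sqrt T) * sqrt (y - x)" by (simp flip: real_sqrt_mult add: right_diff_distrib)
      ultimately show ?thesis using T by simp
    qed
    ultimately show ?thesis by simp
  qed
  moreover have "indep_vars (\<lambda>_. borel) (\<lambda>i \<omega>. rescale T B (x (Suc i)) \<omega> - rescale T B (x i) \<omega>) {..<n}"
    if x: "strict_mono_on {..n} x" for n and x :: "nat \<Rightarrow> real"
  proof -
    have "strict_mono_on {..n} (\<lambda>i. sqrt T * x i)"
      using x T by (simp add: strict_mono_on_def)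
    then have "indep_vars (\<lambda>_. borel) (\<lambda>i \<omega>. B (sqrt T * x (Suc i)) \<omega> - B (sqrt T * x i) \<omega>) {..<n}"
      using B unfolding brownian_motion_def by blast
    from indep_vars_compose2[OF this, of "\<lambda>_ z. z / T powr (1/4)" "\<lambda>_. borel"]
    show ?thesis by (simp add: rescale_def diff_divide_distrib)
  qed
  moreover have "AE \<omega> in M. continuous_on UNIV (\<lambda>x. rescale T B x \<omega>)"
  proof -
    have "AE \<omega> in M. continuous_on UNIV (\<lambda>x. B x \<omega>)" using B by (simp add: brownian_motion_def)
    then show ?thesis
    proof eventually_elim
      case (elim \<omega>)
      then show ?case unfolding rescale_def
        by (intro continuous_intros continuous_on_compose2[OF elim]) (use T in auto)
    qed
  qed
  moreover have "AE \<omega> in M. rescale T B 0 \<omega> = 0"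
    using B by (auto simp: brownian_motion_def rescale_def)
  moreover have "rescale T B x \<in> borel_measurable M" for x unfolding rescale_def[abs_def] by measurable
  ultimately show ?thesis using prob_space_axioms by (simp add: brownian_motion_def)
qed

lemma tame_rescale:
  assumes f: "tame f" and T: "0 < T"
  shows "tame (\<lambda>y. f (sqrt T * y) / T powr (1/4))"
proof -
  have [measurable]: "f \<in> borel_measurable borel" using f by (rule tame_measurable)
  define c where "c = max 1 T"
  have "integrable lborel (\<lambda>y. (f (sqrt T * y))\<^sup>2 / (weight (sqrt T * y))\<^sup>2)"
    using f T lborel_integrable_real_affine[of "\<lambda>y. (f y)\<^sup>2 / (weight y)\<^sup>2" "sqrt T" 0] by (simp add: tame_def)
  then have i: "integrable lborel (\<lambda>y. (c\<^sup>2 / (T powr (1/4))\<^sup>2) * ((f (sqrt T * y))\<^sup>2 / (weight (sqrt T * y))\<^sup>2))"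
    by (rule integrable_mult_right)
  have "integrable lborel (\<lambda>y. (f (sqrt T * y) / T powr (1/4))\<^sup>2 / (weight y)\<^sup>2)"
  proof (rule Bochner_Integration.integrable_bound[OF i])
    have "(f (sqrt T * y) / T powr (1/4))\<^sup>2 / (weight y)\<^sup>2
        \<le> (c\<^sup>2 / (T powr (1/4))\<^sup>2) * ((f (sqrt T * y))\<^sup>2 / (weight (sqrt T * y))\<^sup>2)" for y
    proof -
      have "weight (sqrt T * y) \<le> c * weight y"
      proof -
        have "T * y\<^sup>2 \<le> c * y\<^sup>2" by (rule mult_right_mono) (auto simp: c_def)
        then show ?thesis using T by (simp add: weight_def power_mult_distrib distrib_left) (simp add: c_def)
      qed
      then have "(weight (sqrt T * y))\<^sup>2 \<le> (c * weight y)\<^sup>2" by (rule power_mono) simp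
      then have "1 / (weight y)\<^sup>2 \<le> c\<^sup>2 / (weight (sqrt T * y))\<^sup>2" by (simp add: field_simps power_mult_distrib)
      then have "(f (sqrt T * y) / T powr (1/4))\<^sup>2 * (1 / (weight y)\<^sup>2)
          \<le> (f (sqrt T * y) / T powr (1/4))\<^sup>2 * (c\<^sup>2 / (weight (sqrt T * y))\<^sup>2)"
        by (rule mult_left_mono) simp
      then show ?thesis by (simp add: power_divide mult_ac)
    qed
    then show "AE y in lborel. norm ((f (sqrt T * y) / T powr (1/4))\<^sup>2 / (weight y)\<^sup>2)
        \<le> norm ((c\<^sup>2 / (T powr (1/4))\<^sup>2) * ((f (sqrt T * y))\<^sup>2 / (weight (sqrt T * y))\<^sup>2))"
      by (intro AE_I2) simp
  qed measurable
  then show ?thesis by (simp add: tame_def)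
qed

lemma heat_kernel'_scale:
  assumes "0 < T" "0 < t"
  shows "heat_kernel' (T * t) (sqrt T * z) = heat_kernel' t z / T"
proof -
  have "heat_kernel (T * t) (sqrt T * z) = heat_kernel t z / sqrt T"
    using assms by (simp add: heat_kernel_def power_mult_distrib real_sqrt_mult)
  then have "heat_kernel' (T * t) (sqrt T * z) = - (sqrt T * z) / (2 * (T * t)) * (heat_kernel t z / sqrt T)"
    by (simp add: heat_kernel'_def)
  also have "\<dots> = heat_kernel' t z / T" using assms by (simp add: heat_kernel'_def field_simps)
  finally show ?thesis .
qed

lemma heat_conv'_rescale:
  assumes T: "0 < T" and t: "0 < t"
  shows "heat_conv' (\<lambda>y. f (sqrt T * y) / T powr (1/4)) t x = T powr (1/4) * heat_conv' f (T * t) (sqrt T * x)"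
proof -
  have k: "heat_kernel' (T * t) (sqrt T * x - sqrt T * y) * f (sqrt T * y) = (1 / T) * (heat_kernel' t (x - y) * f (sqrt T * y))" for y
  proof -
    have "sqrt T * x - sqrt T * y = sqrt T * (x - y)" by (simp add: right_diff_distrib)
    then show ?thesis by (simp add: heat_kernel'_scale[OF T t])
  qed
  have "heat_conv' f (T * t) (sqrt T * x)
      = sqrt T * (\<integral>y. heat_kernel' (T * t) (sqrt T * x - sqrt T * y) * f (sqrt T * y) \<partial>lborel)"
    unfolding heat_conv'_def
    using lborel_integral_real_affine[of "sqrt T" "\<lambda>y. heat_kernel' (T * t) (sqrt T * x - y) * f y" 0] T by simp
  also have "\<dots> = sqrt T * (\<integral>y. (1 / T) * (heat_kernel' t (x - y) * f (sqrt T * y)) \<partial>lborel)"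
    by (simp only: k)
  also have "\<dots> = sqrt T / T * (\<integral>y. heat_kernel' t (x - y) * f (sqrt T * y) \<partial>lborel)"
    by (subst integral_mult_right_zero) simp
  also have "(\<integral>y. heat_kernel' t (x - y) * f (sqrt T * y) \<partial>lborel)
      = T powr (1/4) * heat_conv' (\<lambda>y. f (sqrt T * y) / T powr (1/4)) t x"
    using T by (simp add: heat_conv'_def)
  finally have "T powr (1/4) * heat_conv' f (T * t) (sqrt T * x)
      = (T powr (1/4) * (sqrt T / T) * T powr (1/4)) * heat_conv' (\<lambda>y. f (sqrt T * y) / T powr (1/4)) t x"
    by simp
  also have "T powr (1/4) * (sqrt T / T) * T powr (1/4) = 1"
  proof -
    have "T powr (1/4) * T powr (1/4) = sqrt T" using T by (simp add: powr_half_sqrt flip: powr_add)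
    moreover have "T powr (1/4) * (sqrt T / T) * T powr (1/4) = (T powr (1/4) * T powr (1/4)) * sqrt T / T"
      by simp
    ultimately show ?thesis using T by simp
  qed
  finally show ?thesis by simp
qed

lemma (in tame_brownian) tame_brownian_rescale:
  assumes T: "0 < T" shows "tame_brownian M (rescale T B)"
proof unfold_locales
  show "brownian_motion M (rescale T B)" by (rule brownian_motion_rescale[OF brownian T])
  show "continuous_on UNIV (\<lambda>x. rescale T B x \<omega>)" for \<omega>
    unfolding rescale_def
    by (intro continuous_intros continuous_on_compose2[OF path_continuous]) (use T in auto)
  show "rescale T B 0 \<omega> = 0" for \<omega> by (simp add: rescale_def path_0)
  show "tame (\<lambda>y. rescale T B y \<omega>)" for \<omega>
    unfolding rescale_def by (rule tame_rescale[OF path_tame T])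
qed

section \<open>Convergence of the rescaled process\<close>

lemma (in prob_space) expectation_close:
  fixes a b :: "'a \<Rightarrow> real"
  assumes [measurable]: "a \<in> borel_measurable M" "b \<in> borel_measurable M" "A \<in> events"
    and c: "\<And>\<omega>. \<omega> \<in> space M \<Longrightarrow> \<bar>a \<omega>\<bar> \<le> c" "\<And>\<omega>. \<omega> \<in> space M \<Longrightarrow> \<bar>b \<omega>\<bar> \<le> c"
    and e: "\<And>\<omega>. \<omega> \<in> space M - A \<Longrightarrow> \<bar>a \<omega> - b \<omega>\<bar> \<le> e" and "0 \<le> e"
  shows "\<bar>expectation a - expectation b\<bar> \<le> e + 2 * c * prob A"
proof -
  have i: "integrable M a" "integrable M b" using c by (auto intro!: integrable_const_bound[where B=c])
  have "\<bar>expectation a - expectation b\<bar> = \<bar>expectation (\<lambda>\<omega>. a \<omega> - b \<omega>)\<bar>" using i by simp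
  also have "\<dots> \<le> expectation (\<lambda>\<omega>. \<bar>a \<omega> - b \<omega>\<bar>)" by (rule integral_abs_bound)
  also have "\<dots> \<le> expectation (\<lambda>\<omega>. e + 2 * c * indicator A \<omega>)"
  proof (rule integral_mono)
    fix \<omega> assume w: "\<omega> \<in> space M"
    show "\<bar>a \<omega> - b \<omega>\<bar> \<le> e + 2 * c * indicator A \<omega>"
      using c(1)[OF w] c(2)[OF w] e[of \<omega>] w \<open>0 \<le> e\<close> by (cases "\<omega> \<in> A") auto
  qed (use i in \<open>auto intro!: Bochner_Integration.integrable_add integrable_mult_right integrable_real_indicator simp: emeasure_eq_measure\<close>)
  also have "\<dots> = e + 2 * c * prob A"
    by (subst Bochner_Integration.integral_add)
      (auto simp: prob_space emeasure_eq_measure sets.Int_space_eq2)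
  finally show ?thesis .
qed

lemma ucc_measurable_space: "Y \<in> M \<rightarrow>\<^sub>M borel_of ucc_topology \<Longrightarrow> \<omega> \<in> space M \<Longrightarrow> Y \<omega> \<in> cont_fun_space"
  using measurable_space[of Y M "borel_of ucc_topology" \<omega>] by (simp add: topspace_ucc_topology)

context tame_brownian
begin

lemma path_grid_measurable: "(\<lambda>\<omega>. vel_path (\<lambda>y. B (grid n y) \<omega>)) \<in> M \<rightarrow>\<^sub>M borel_of ucc_topology"
  unfolding grid_def by (rule vel_path_grid_measurable) measurable

lemma path_grid_tame: "tame (\<lambda>y. B (grid n y) \<omega>)"
  unfolding grid_def by (rule tame_grid)

lemma vel_path_measurable: "(\<lambda>\<omega>. vel_path (\<lambda>y. B y \<omega>)) \<in> M \<rightarrow>\<^sub>M borel_of ucc_topology"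
proof (rule measurable_borel_of_uccI)
  show "vel_path (\<lambda>y. B y \<omega>) \<in> cont_fun_space" for \<omega> by (rule vel_path_in[OF path_tame])
  fix t :: real assume "0 \<le> t"
  then have "vel_path (\<lambda>y. B y \<omega>) t = (LINT s:{0..t}|lborel. - (\<integral>y. heat_kernel' s (0 - y) * B y \<omega> \<partial>lborel))" for \<omega>
    using vel_int_eq_LINT[OF path_tame] by (simp add: vel_path_def heat_conv'_def)
  then show "(\<lambda>\<omega>. vel_path (\<lambda>y. B y \<omega>) t) \<in> borel_measurable M"
    unfolding set_lebesgue_integral_def by simp
qed

lemma expectation_grid_close:
  assumes Y: "Y \<in> M \<rightarrow>\<^sub>M borel_of ucc_topology"
    and \<psi>: "ucc_lipschitz k \<psi>" "\<And>f. f \<in> cont_fun_space \<Longrightarrow> \<bar>\<psi> f\<bar> \<le> b"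
    and pos: "0 \<le> \<eta>" "0 < \<kappa>" "0 < R" "0 \<le> C"
    and near: "\<And>\<omega> \<theta>. wnorm2 (\<lambda>y. B y \<omega>) < R \<Longrightarrow> \<theta> \<in> {0..real k} \<Longrightarrow> \<bar>Y \<omega> \<theta> - vel_int (\<lambda>y. B y \<omega>) \<theta>\<bar> \<le> \<eta>"
    and C: "\<And>f g \<theta>. tame f \<Longrightarrow> tame g \<Longrightarrow> \<theta> \<in> {0..real k} \<Longrightarrow>
        \<bar>vel_int f \<theta> - vel_int g \<theta>\<bar> \<le> C * (\<kappa> + wnorm2 (\<lambda>y. f y - g y) / \<kappa>)"
  shows "\<bar>expectation (\<lambda>\<omega>. \<psi> (Y \<omega>)) - expectation (\<lambda>\<omega>. \<psi> (vel_path (\<lambda>y. B (grid n y) \<omega>)))\<bar>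
    \<le> real k * (\<eta> + 2 * C * \<kappa>) + 2 * b * ((\<integral>y. \<bar>y\<bar> / (weight y)\<^sup>2 \<partial>lborel) / R + grid_error n / \<kappa>\<^sup>2)"
proof -
  let ?V = "\<lambda>\<omega>. vel_path (\<lambda>y. B (grid n y) \<omega>)"
  let ?d = "\<lambda>\<omega>. wnorm2 (\<lambda>y. B y \<omega> - B (grid n y) \<omega>)"
  define A1 where "A1 = {\<omega> \<in> space M. R \<le> wnorm2 (\<lambda>y. B y \<omega>)}"
  define A2 where "A2 = {\<omega> \<in> space M. \<kappa>\<^sup>2 \<le> ?d \<omega>}"
  have b: "0 \<le> b" using \<psi>(2)[OF vel_path_in[OF path_tame]] abs_ge_zero order_trans by blast
  have hd: "integrable M ?d" "expectation ?d = grid_error n"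
    using expectation_wnorm2[OF grid_measurable grid_close path_grid_tame, of n]
    by (auto simp: has_bochner_integral_iff grid_error_def)
  have [measurable]: "?d \<in> borel_measurable M" using hd(1) by auto
  have A: "A1 \<in> events" "A2 \<in> events" unfolding A1_def A2_def by measurable
  have P1: "prob A1 \<le> (\<integral>y. \<bar>y\<bar> / (weight y)\<^sup>2 \<partial>lborel) / R"
    unfolding A1_def by (rule prob_wnorm2_ge[OF pos(3)])
  have P2: "prob A2 \<le> grid_error n / \<kappa>\<^sup>2"
    unfolding A2_def hd(2)[symmetric]
    by (rule integral_Markov_inequality_measure[OF hd(1) sets.top]) (use pos in auto)
  have m: "(\<lambda>\<omega>. \<psi> (V \<omega>)) \<in> borel_measurable M" if "V \<in> M \<rightarrow>\<^sub>M borel_of ucc_topology" for V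
    by (rule measurable_compose[OF that continuous_map_borel_measurable[OF ucc_lipschitz_continuous[OF \<psi>(1)]]])
  have "\<bar>expectation (\<lambda>\<omega>. \<psi> (Y \<omega>)) - expectation (\<lambda>\<omega>. \<psi> (?V \<omega>))\<bar>
      \<le> real k * (\<eta> + 2 * C * \<kappa>) + 2 * b * prob (A1 \<union> A2)"
  proof (rule expectation_close[OF m[OF Y] m[OF path_grid_measurable]])
    fix \<omega> assume w: "\<omega> \<in> space M - (A1 \<union> A2)"
    have s: "Y \<omega> \<in> cont_fun_space" "?V \<omega> \<in> cont_fun_space"
      using w ucc_measurable_space[OF Y] vel_path_in[OF path_grid_tame] by auto
    have "\<forall>\<theta>\<in>{0..real k}. \<bar>Y \<omega> \<theta> - ?V \<omega> \<theta>\<bar> \<le> \<eta> + 2 * C * \<kappa>"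
    proof
      fix \<theta> assume \<theta>: "\<theta> \<in> {0..real k}"
      have 1: "\<bar>Y \<omega> \<theta> - vel_int (\<lambda>y. B y \<omega>) \<theta>\<bar> \<le> \<eta>"
        by (rule near[OF _ \<theta>]) (use w in \<open>auto simp: A1_def\<close>)
      have "?d \<omega> / \<kappa> \<le> \<kappa>\<^sup>2 / \<kappa>" using w pos by (intro divide_right_mono) (auto simp: A2_def)
      also have "\<dots> = \<kappa>" using pos by (simp add: power2_eq_square)
      finally have "C * (\<kappa> + ?d \<omega> / \<kappa>) \<le> C * (\<kappa> + \<kappa>)" using pos by (intro mult_left_mono) auto
      with C[OF path_tame path_grid_tame \<theta>, of \<omega> n \<omega>]
      have 2: "\<bar>vel_int (\<lambda>y. B y \<omega>) \<theta> - vel_int (\<lambda>y. B (grid n y) \<omega>) \<theta>\<bar> \<le> 2 * C * \<kappa>" by simp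
      show "\<bar>Y \<omega> \<theta> - ?V \<omega> \<theta>\<bar> \<le> \<eta> + 2 * C * \<kappa>" using 1 2 \<theta> by (simp add: vel_path_def)
    qed
    then show "\<bar>\<psi> (Y \<omega>) - \<psi> (?V \<omega>)\<bar> \<le> real k * (\<eta> + 2 * C * \<kappa>)"
      using \<psi>(1) s unfolding ucc_lipschitz_def by blast
  qed (use A pos \<psi>(2) ucc_measurable_space[OF Y] vel_path_in[OF path_grid_tame] in auto)
  also have "\<dots> \<le> real k * (\<eta> + 2 * C * \<kappa>) + 2 * b * ((\<integral>y. \<bar>y\<bar> / (weight y)\<^sup>2 \<partial>lborel) / R + grid_error n / \<kappa>\<^sup>2)"
    using measure_Un_le[OF A] P1 P2 b by (intro add_left_mono mult_left_mono) auto
  finally show ?thesis .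
qed

end

locale driven_path = tame_brownian +
  fixes X :: "real \<Rightarrow> 'a \<Rightarrow> real"
  assumes X_measurable: "\<And>t. 0 \<le> t \<Longrightarrow> X t \<in> borel_measurable M"
    and X_continuous: "\<And>\<omega>. continuous_on {0..} (\<lambda>t. X t \<omega>)"
    and X_0: "\<And>\<omega>. X 0 \<omega> = 0"
    and X_ode: "\<And>\<omega> t. 0 < t \<Longrightarrow>
      ((\<lambda>s. X s \<omega>) has_real_derivative - heat_conv' (\<lambda>y. B y \<omega>) t (X t \<omega>)) (at t)"
begin

definition scaled_path :: "real \<Rightarrow> 'a \<Rightarrow> real \<Rightarrow> real" where
  "scaled_path T \<omega> = (\<lambda>\<theta>\<in>{0..}. X (\<theta> * T) \<omega> / T powr (3/4))"

lemma scaled_path_continuous: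
  assumes "0 < T" shows "continuous_on {0..} (\<lambda>\<theta>. X (\<theta> * T) \<omega> / T powr (3/4))"
  by (intro continuous_intros continuous_on_compose2[OF X_continuous]) (use assms in auto)

lemma scaled_path_measurable:
  assumes "0 < T" shows "scaled_path T \<in> M \<rightarrow>\<^sub>M borel_of ucc_topology"
proof (rule measurable_borel_of_uccI)
  show "scaled_path T \<omega> \<in> cont_fun_space" for \<omega>
    unfolding scaled_path_def by (rule restrict_in_cont_fun_space[OF scaled_path_continuous[OF assms]])
  fix t :: real assume t: "0 \<le> t"
  then have [measurable]: "X (t * T) \<in> borel_measurable M" using assms by (intro X_measurable) simp
  show "(\<lambda>\<omega>. scaled_path T \<omega> t) \<in> borel_measurable M" using t by (simp add: scaled_path_def)
qed

lemma scaled_path_ode: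
  assumes T: "0 < T" and s: "0 < s"
  shows "((\<lambda>\<theta>. X (\<theta> * T) \<omega> / T powr (3/4)) has_real_derivative
    - heat_conv' (\<lambda>y. rescale T B y \<omega>) s (T powr (1/4) * (X (s * T) \<omega> / T powr (3/4)))) (at s)"
proof -
  have T4: "T powr (3/4) = sqrt T * T powr (1/4)" "T = T powr (3/4) * T powr (1/4)"
    using T by (simp_all add: powr_half_sqrt[symmetric] flip: powr_add)
  have "sqrt T * (T powr (1/4) * (X (s * T) \<omega> / T powr (3/4))) = X (s * T) \<omega>"
    unfolding T4(1) using T by simp
  moreover have "heat_conv' (\<lambda>y. rescale T B y \<omega>) s x = T powr (1/4) * heat_conv' (\<lambda>y. B y \<omega>) (s * T) (sqrt T * x)" for x
    unfolding rescale_def mult.commute[of s T] by (rule heat_conv'_rescale[OF T s, of "\<lambda>y. B y \<omega>"])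
  ultimately have eq: "heat_conv' (\<lambda>y. rescale T B y \<omega>) s (T powr (1/4) * (X (s * T) \<omega> / T powr (3/4)))
      = T powr (1/4) * heat_conv' (\<lambda>y. B y \<omega>) (s * T) (X (s * T) \<omega>)"
    by simp
  have "((\<lambda>\<theta>. X (\<theta> * T) \<omega>) has_real_derivative - heat_conv' (\<lambda>y. B y \<omega>) (s * T) (X (s * T) \<omega>) * T) (at s)"
    by (rule DERIV_chain2[where f="\<lambda>r. X r \<omega>" and g="\<lambda>\<theta>. \<theta> * T", OF X_ode])
      (use T s in \<open>auto intro!: derivative_eq_intros\<close>)
  then have "((\<lambda>\<theta>. X (\<theta> * T) \<omega> / T powr (3/4)) has_real_derivative
      - heat_conv' (\<lambda>y. B y \<omega>) (s * T) (X (s * T) \<omega>) * T / T powr (3/4)) (at s)"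
    by (rule DERIV_cdivide)
  moreover have "T / T powr (3/4) = T powr (1/4)" using T4(2) T by (metis nonzero_mult_div_cancel_left powr_eq_0_iff less_irrefl)
  moreover have "- heat_conv' (\<lambda>y. B y \<omega>) (s * T) (X (s * T) \<omega>) * T / T powr (3/4)
      = - (T / T powr (3/4) * heat_conv' (\<lambda>y. B y \<omega>) (s * T) (X (s * T) \<omega>))" by simp
  ultimately show ?thesis unfolding eq by (simp only:)
qed

lemma expectation_lipschitz_tendsto:
  assumes \<psi>: "ucc_lipschitz k \<psi>" "\<And>f. f \<in> cont_fun_space \<Longrightarrow> \<bar>\<psi> f\<bar> \<le> b"
  shows "((\<lambda>T. expectation (\<lambda>\<omega>. \<psi> (scaled_path T \<omega>))) \<longlongrightarrow> expectation (\<lambda>\<omega>. \<psi> (vel_path (\<lambda>y. B y \<omega>)))) (at_right 0)"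
proof (rule tendstoI)
  fix e :: real assume e: "0 < e"
  have b: "0 \<le> b" using \<psi>(2)[OF vel_path_in[OF path_tame]] abs_ge_zero order_trans by blast
  define L where "L = real k + 1"
  have L: "0 < L" "real k < L" by (auto simp: L_def)
  obtain C where C: "0 < C" "\<And>f g \<kappa> \<theta>. tame f \<Longrightarrow> tame g \<Longrightarrow> 0 < \<kappa> \<Longrightarrow> \<theta> \<in> {0..L} \<Longrightarrow>
     \<bar>vel_int f \<theta> - vel_int g \<theta>\<bar> \<le> C * (\<kappa> + wnorm2 (\<lambda>y. f y - g y) / \<kappa>)"
    by (rule vel_int_diff_bound[OF L(1)]) (rule that)
  define I where "I = (\<integral>y. \<bar>y\<bar> / (weight y)\<^sup>2 \<partial>lborel)"
  have I: "0 \<le> I" unfolding I_def by (intro integral_nonneg_AE AE_I2) simp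
  define \<kappa> where "\<kappa> = e / (16 * C * L)"
  define \<eta> where "\<eta> = e / (8 * L)"
  define R where "R = 32 * b * I / e + 1"
  have \<kappa>: "0 < \<kappa>" and \<eta>: "0 < \<eta>" and R: "0 < R"
    using e C(1) L(1) b I by (auto simp: \<kappa>_def \<eta>_def R_def intro!: add_nonneg_pos)
  have k1: "real k * (\<eta> + 2 * C * \<kappa>) \<le> e / 4"
  proof -
    have "\<eta> + 2 * C * \<kappa> = e / (4 * L)" using C(1) L(1) by (simp add: \<eta>_def \<kappa>_def field_simps)
    then have "real k * (\<eta> + 2 * C * \<kappa>) \<le> L * (e / (4 * L))" using L e by (simp only:) (intro mult_right_mono, auto)
    then show ?thesis using L by simp
  qed
  have k2: "2 * b * (I / R) \<le> e / 16"
  proof -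
    have "32 * b * I \<le> e * R" using e by (simp add: R_def distrib_left)
    then show ?thesis using R by (simp add: field_simps)
  qed
  have "(\<lambda>n. 2 * b * (grid_error n / \<kappa>\<^sup>2)) \<longlonglongrightarrow> 2 * b * (0 / \<kappa>\<^sup>2)"
    using \<kappa> by (intro tendsto_intros grid_error_tendsto) auto
  then have "\<forall>\<^sub>F n in sequentially. 2 * b * (grid_error n / \<kappa>\<^sup>2) < e / 16"
    by (rule order_tendstoD) (use e in simp)
  then have "\<forall>\<^sub>F n in sequentially. 2 * b * (grid_error n / \<kappa>\<^sup>2) < e / 16 \<and> 0 < n"
    by (rule eventually_conj) (rule eventually_gt_at_top)
  then obtain n where n: "2 * b * (grid_error n / \<kappa>\<^sup>2) < e / 16" "0 < n"
    by (auto dest: eventually_happens)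
  have total: "real k * (\<eta> + 2 * C * \<kappa>) + 2 * b * (I / R + grid_error n / \<kappa>\<^sup>2) < e / 2"
    using k1 k2 n(1) e unfolding distrib_left[of "2 * b"] by linarith
  obtain \<epsilon>0 where \<epsilon>0: "0 < \<epsilon>0"
    "\<And>\<epsilon> f Y \<theta>. \<lbrakk>0 < \<epsilon>; \<epsilon> < \<epsilon>0; tame f; wnorm2 f \<le> R; continuous_on {0..L} Y; Y 0 = 0;
      \<forall>s. 0 < s \<and> s < L \<longrightarrow> (Y has_real_derivative - heat_conv' f s (\<epsilon> * Y s)) (at s); \<theta> \<in> {0..L}\<rbrakk>
     \<Longrightarrow> \<bar>Y \<theta> - vel_int f \<theta>\<bar> \<le> \<eta>"
    by (rule ode_close[OF L(1) less_imp_le[OF R] \<eta>]) (rule that)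
  let ?Z = "\<lambda>\<omega>. vel_path (\<lambda>y. B y \<omega>)"
  have CC: "\<bar>vel_int f \<theta> - vel_int g \<theta>\<bar> \<le> C * (\<kappa> + wnorm2 (\<lambda>y. f y - g y) / \<kappa>)"
    if "tame f" "tame g" "\<theta> \<in> {0..real k}" for f g \<theta>
    using C(2)[OF that(1,2) \<kappa>] that(3) L by auto
  have Z_close: "\<bar>expectation (\<lambda>\<omega>. \<psi> (?Z \<omega>)) - expectation (\<lambda>\<omega>. \<psi> (vel_path (\<lambda>y. B (grid n y) \<omega>)))\<bar>
      \<le> real k * (\<eta> + 2 * C * \<kappa>) + 2 * b * (I / R + grid_error n / \<kappa>\<^sup>2)"
    unfolding I_def
  proof (rule expectation_grid_close[OF vel_path_measurable \<psi> less_imp_le[OF \<eta>] \<kappa> R less_imp_le[OF C(1)] _ CC])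
    show "\<bar>?Z \<omega> \<theta> - vel_int (\<lambda>y. B y \<omega>) \<theta>\<bar> \<le> \<eta>" if "\<theta> \<in> {0..real k}" for \<omega> \<theta>
      using that \<eta> by (simp add: vel_path_def)
  qed
  have \<psi>_meas: "\<psi> \<in> borel_measurable (borel_of ucc_topology)"
    by (rule continuous_map_borel_measurable[OF ucc_lipschitz_continuous[OF \<psi>(1)]])
  have "((\<lambda>T::real. T powr (1/4)) \<longlongrightarrow> 0 powr (1/4)) (at_right 0)"
    by (rule tendsto_powr'[OF tendsto_ident_at tendsto_const])
      (use eventually_at_right_less[of "0::real"] in \<open>auto elim: eventually_mono\<close>)
  then have "\<forall>\<^sub>F T::real in at_right 0. T powr (1/4) < \<epsilon>0"
    by (rule order_tendstoD) (use \<epsilon>0(1) in simp)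
  moreover have "\<forall>\<^sub>F T::real in at_right 0. 0 < T" by (rule eventually_at_right_less)
  ultimately show "\<forall>\<^sub>F T in at_right 0. dist (expectation (\<lambda>\<omega>. \<psi> (scaled_path T \<omega>))) (expectation (\<lambda>\<omega>. \<psi> (?Z \<omega>))) < e"
  proof eventually_elim
    case (elim T)
    note T = elim(2)
    interpret R: tame_brownian M "rescale T B" by (rule tame_brownian_rescale[OF T])
    have "\<bar>expectation (\<lambda>\<omega>. \<psi> (scaled_path T \<omega>)) - expectation (\<lambda>\<omega>. \<psi> (vel_path (\<lambda>y. rescale T B (grid n y) \<omega>)))\<bar>
        \<le> real k * (\<eta> + 2 * C * \<kappa>) + 2 * b * (I / R + grid_error n / \<kappa>\<^sup>2)"
      unfolding I_def
    proof (rule R.expectation_grid_close[OF scaled_path_measurable[OF T] \<psi> less_imp_le[OF \<eta>] \<kappa> R less_imp_le[OF C(1)] _ CC])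
      fix \<omega> \<theta> assume w: "wnorm2 (\<lambda>y. rescale T B y \<omega>) < R" and \<theta>: "\<theta> \<in> {0..real k}"
      have "\<bar>X (\<theta> * T) \<omega> / T powr (3/4) - vel_int (\<lambda>y. rescale T B y \<omega>) \<theta>\<bar> \<le> \<eta>"
      proof (rule \<epsilon>0(2)[of "T powr (1/4)" "\<lambda>y. rescale T B y \<omega>" "\<lambda>\<theta>. X (\<theta> * T) \<omega> / T powr (3/4)"])
        show "continuous_on {0..L} (\<lambda>\<theta>. X (\<theta> * T) \<omega> / T powr (3/4))"
          by (rule continuous_on_subset[OF scaled_path_continuous[OF T]]) auto
        show "X (0 * T) \<omega> / T powr (3/4) = 0" by (simp add: X_0)
        show "\<theta> \<in> {0..L}" using \<theta> L by auto
        show "\<forall>s. 0 < s \<and> s < L \<longrightarrow> ((\<lambda>\<theta>. X (\<theta> * T) \<omega> / T powr (3/4)) has_real_derivative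
            - heat_conv' (\<lambda>y. rescale T B y \<omega>) s (T powr (1/4) * (X (s * T) \<omega> / T powr (3/4)))) (at s)"
          using scaled_path_ode[OF T] by blast
        show "T powr (1/4) < \<epsilon>0" by (rule elim(1))
      qed (use w T R.path_tame in auto)
      then show "\<bar>scaled_path T \<omega> \<theta> - vel_int (\<lambda>y. rescale T B y \<omega>) \<theta>\<bar> \<le> \<eta>" using \<theta> by (simp add: scaled_path_def)
    qed
    moreover have "expectation (\<lambda>\<omega>. \<psi> (vel_path (\<lambda>y. rescale T B (grid n y) \<omega>))) = expectation (\<lambda>\<omega>. \<psi> (vel_path (\<lambda>y. B (grid n y) \<omega>)))"
      unfolding expectation_grid[OF n(2) \<psi>_meas] R.expectation_grid[OF n(2) \<psi>_meas] ..
    ultimately show ?case using Z_close total unfolding dist_real_def by linarith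
  qed
qed

end

section \<open>Modification on a null set\<close>

definition modify :: "'a set \<Rightarrow> (real \<Rightarrow> 'a \<Rightarrow> real) \<Rightarrow> real \<Rightarrow> 'a \<Rightarrow> real" where
  "modify G B x \<omega> = (if \<omega> \<in> G then B x \<omega> else 0)"

lemma modify_measurable:
  assumes "B x \<in> borel_measurable M" "G \<in> sets M"
  shows "modify G B x \<in> borel_measurable M"
  unfolding modify_def[abs_def] using assms by measurable

lemma (in prob_space) indep_vars_AE_cong:
  fixes V W :: "'i \<Rightarrow> 'a \<Rightarrow> real"
  assumes V: "indep_vars (\<lambda>_. borel) V I" and VW: "\<And>i. AE \<omega> in M. V i \<omega> = W i \<omega>"
    and [measurable]: "\<And>i. V i \<in> borel_measurable M" "\<And>i. W i \<in> borel_measurable M" and "finite I"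
  shows "indep_vars (\<lambda>_. borel) W I"
proof (cases "I = {}")
  case True
  then show ?thesis by (simp add: indep_vars_def indep_sets_def)
next
  case False
  have "distr M (Pi\<^sub>M I (\<lambda>_. borel)) (\<lambda>\<omega>. \<lambda>i\<in>I. W i \<omega>) = distr M (Pi\<^sub>M I (\<lambda>_. borel)) (\<lambda>\<omega>. \<lambda>i\<in>I. V i \<omega>)"
  proof (rule distr_cong_AE)
    have "AE \<omega> in M. \<forall>i\<in>I. V i \<omega> = W i \<omega>" using \<open>finite I\<close> VW by (simp add: AE_finite_all)
    then show "AE \<omega> in M. (\<lambda>i\<in>I. W i \<omega>) = (\<lambda>i\<in>I. V i \<omega>)"
      by eventually_elim (auto simp: restrict_def)
  qed measurable
  also have "\<dots> = Pi\<^sub>M I (\<lambda>i. distr M borel (V i))"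
    using V False by (subst (asm) indep_vars_iff_distr_eq_PiM) auto
  also have "\<dots> = Pi\<^sub>M I (\<lambda>i. distr M borel (W i))"
    by (intro PiM_cong refl distr_cong_AE VW) measurable
  finally show ?thesis using False by (subst indep_vars_iff_distr_eq_PiM) auto
qed

lemma brownian_motion_modify:
  assumes B: "brownian_motion M B" and G: "G \<in> sets M" "AE \<omega> in M. \<omega> \<in> G"
  shows "brownian_motion M (modify G B)"
proof -
  interpret prob_space M using B by (simp add: brownian_motion_def)
  have Bm [measurable]: "B x \<in> borel_measurable M" for x using B by (simp add: brownian_motion_def)
  have mm [measurable]: "modify G B x \<in> borel_measurable M" for x by (rule modify_measurable[OF Bm G(1)])
  have eq: "AE \<omega> in M. modify G B y \<omega> - modify G B x \<omega> = B y \<omega> - B x \<omega>" for x y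
    using G(2) by eventually_elim (simp add: modify_def)
  have eq': "AE \<omega> in M. B y \<omega> - B x \<omega> = modify G B y \<omega> - modify G B x \<omega>" for x y
    using G(2) by eventually_elim (simp add: modify_def)
  have "distributed M lborel (\<lambda>\<omega>. modify G B y \<omega> - modify G B x \<omega>) (normal_density 0 (sqrt (y - x)))" if "x < y" for x y
  proof -
    have "distributed M lborel (\<lambda>\<omega>. B y \<omega> - B x \<omega>) (normal_density 0 (sqrt (y - x)))"
      using B that by (simp add: brownian_motion_def)
    moreover have "distr M lborel (\<lambda>\<omega>. modify G B y \<omega> - modify G B x \<omega>) = distr M lborel (\<lambda>\<omega>. B y \<omega> - B x \<omega>)"
      by (intro distr_cong_AE eq) measurable
    ultimately show ?thesis by (simp add: distributed_def)
  qed
  moreover have "indep_vars (\<lambda>_. borel) (\<lambda>i \<omega>. modify G B (x (Suc i)) \<omega> - modify G B (x i) \<omega>) {..<n}"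
    if "strict_mono_on {..n} x" for n and x :: "nat \<Rightarrow> real"
    by (rule indep_vars_AE_cong[OF _ eq']) (use B that in \<open>auto simp: brownian_motion_def\<close>)
  moreover have "AE \<omega> in M. continuous_on UNIV (\<lambda>x. modify G B x \<omega>)"
  proof -
    have "AE \<omega> in M. continuous_on UNIV (\<lambda>x. B x \<omega>)" using B by (simp add: brownian_motion_def)
    then show ?thesis using G(2) by eventually_elim (simp add: modify_def)
  qed
  moreover have "AE \<omega> in M. modify G B 0 \<omega> = 0"
  proof -
    have "AE \<omega> in M. B 0 \<omega> = 0" using B by (simp add: brownian_motion_def)
    then show ?thesis by eventually_elim (simp add: modify_def)
  qed
  ultimately show ?thesis using prob_space_axioms by (simp add: brownian_motion_def)
qed

lemma brownian_path_modify:
  assumes B: "brownian_motion M B" and G: "G \<in> sets M" "AE \<omega> in M. \<omega> \<in> G"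
    and c: "\<And>\<omega>. \<omega> \<in> G \<Longrightarrow> continuous_on UNIV (\<lambda>x. B x \<omega>)" and z: "\<And>\<omega>. \<omega> \<in> G \<Longrightarrow> B 0 \<omega> = 0"
  shows "brownian_path M (modify G B)"
proof -
  interpret prob_space M using B by (simp add: brownian_motion_def)
  show ?thesis
  proof unfold_locales
    show "brownian_motion M (modify G B)" by (rule brownian_motion_modify[OF B G])
    show "continuous_on UNIV (\<lambda>x. modify G B x \<omega>)" for \<omega>
      using c[of \<omega>] by (cases "\<omega> \<in> G") (auto simp: modify_def)
    show "modify G B 0 \<omega> = 0" for \<omega> using z by (simp add: modify_def)
  qed
qed

lemma AE_obtain_set:
  assumes "AE \<omega> in M. P \<omega>"
  obtains G where "G \<in> sets M" "AE \<omega> in M. \<omega> \<in> G" "\<And>\<omega>. \<omega> \<in> G \<Longrightarrow> P \<omega>"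
proof -
  obtain N where N: "{\<omega> \<in> space M. \<not> P \<omega>} \<subseteq> N" "N \<in> null_sets M"
    using assms by (auto simp: eventually_ae_filter)
  show ?thesis
  proof (rule that[of "space M - N"])
    show "AE \<omega> in M. \<omega> \<in> space M - N" using AE_not_in[OF N(2)] by (auto elim: AE_mp intro!: AE_I2)
  qed (use N in auto)
qed

lemma AE_tame_brownian_motion:
  assumes "brownian_motion M B" shows "AE \<omega> in M. tame (\<lambda>y. B y \<omega>)"
proof -
  have "AE \<omega> in M. continuous_on UNIV (\<lambda>x. B x \<omega>) \<and> B 0 \<omega> = 0"
    using assms by (simp add: brownian_motion_def)
  then obtain G where G: "G \<in> sets M" "AE \<omega> in M. \<omega> \<in> G"
      "\<And>\<omega>. \<omega> \<in> G \<Longrightarrow> continuous_on UNIV (\<lambda>x. B x \<omega>) \<and> B 0 \<omega> = 0"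
    by (rule AE_obtain_set) (rule that)
  interpret brownian_path M "modify G B" by (rule brownian_path_modify[OF assms G(1,2)]) (use G(3) in auto)
  show ?thesis using AE_tame G(2) by eventually_elim (simp add: modify_def)
qed

lemma vel_path_eq_velocity:
  assumes "tame (\<lambda>y. B y \<omega>)"
  shows "vel_path (\<lambda>y. B y \<omega>) = (\<lambda>\<theta>\<in>{0..}. LINT s:{0..\<theta>}|lborel. velocity B s 0 \<omega>)"
  unfolding vel_path_def
proof (rule restrict_ext)
  fix \<theta> :: real
  have "(LINT s:{0..\<theta>}|lborel. - heat_conv' (\<lambda>y. B y \<omega>) s 0) = (LINT s:{0..\<theta>}|lborel. velocity B s 0 \<omega>)"
    unfolding set_lebesgue_integral_def
    by (rule integral_discrete_difference[where X="{0}"])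
       (auto simp: indicator_def velocity_eq_heat_conv[of B \<omega>, OF assms])
  then show "vel_int (\<lambda>y. B y \<omega>) \<theta> = (LINT s:{0..\<theta>}|lborel. velocity B s 0 \<omega>)"
    by (simp add: vel_int_eq_LINT[OF assms])
qed

theorem theorem2:
  fixes M :: "'a measure" and B X :: "real \<Rightarrow> 'a \<Rightarrow> real"
  assumes "prob_space M"
    and "brownian_motion M B"
    and "driven_process M B X"
  shows "converges_in_law M ucc_topology
           (\<lambda>T \<omega>. \<lambda>\<theta>\<in>{0..}. X (\<theta> * T) \<omega> / T powr (3/4))
           (\<lambda>\<omega>. \<lambda>\<theta>\<in>{0..}. LINT s:{0..\<theta>}|lborel. velocity B s 0 \<omega>)
           (at_right 0)"
proof -
  interpret prob_space M by fact
  have "AE \<omega> in M. continuous_on UNIV (\<lambda>x. B x \<omega>)" "AE \<omega> in M. B 0 \<omega> = 0"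
    using assms(2) by (simp_all add: brownian_motion_def)
  moreover have "AE \<omega> in M. continuous_on {0..} (\<lambda>t. X t \<omega>)" "AE \<omega> in M. X 0 \<omega> = 0"
      "AE \<omega> in M. \<forall>t>0. ((\<lambda>s. X s \<omega>) has_real_derivative velocity B t (X t \<omega>) \<omega>) (at t)"
    using assms(3) by (simp_all add: driven_process_def)
  moreover note AE_tame_brownian_motion[OF assms(2)]
  ultimately have "AE \<omega> in M. continuous_on UNIV (\<lambda>x. B x \<omega>) \<and> B 0 \<omega> = 0 \<and> continuous_on {0..} (\<lambda>t. X t \<omega>) \<and> X 0 \<omega> = 0
      \<and> (\<forall>t>0. ((\<lambda>s. X s \<omega>) has_real_derivative velocity B t (X t \<omega>) \<omega>) (at t)) \<and> tame (\<lambda>y. B y \<omega>)"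
    by eventually_elim simp
  then obtain G where G: "G \<in> sets M" "AE \<omega> in M. \<omega> \<in> G"
    and good: "\<And>\<omega>. \<omega> \<in> G \<Longrightarrow> continuous_on UNIV (\<lambda>x. B x \<omega>) \<and> B 0 \<omega> = 0 \<and> continuous_on {0..} (\<lambda>t. X t \<omega>) \<and> X 0 \<omega> = 0
      \<and> (\<forall>t>0. ((\<lambda>s. X s \<omega>) has_real_derivative velocity B t (X t \<omega>) \<omega>) (at t)) \<and> tame (\<lambda>y. B y \<omega>)"
    by (rule AE_obtain_set) (rule that)
  interpret B: brownian_path M "modify G B"
    by (rule brownian_path_modify[OF assms(2) G]) (use good in auto)
  interpret D: driven_path M "modify G B" "modify G X"
  proof unfold_locales
    show "tame (\<lambda>y. modify G B y \<omega>)" for \<omega>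
      using good[of \<omega>] by (cases "\<omega> \<in> G") (auto simp: modify_def tame_def)
    show "modify G X t \<in> borel_measurable M" if "0 \<le> t" for t
      using assms(3) that G(1) by (intro modify_measurable) (auto simp: driven_process_def)
    show "continuous_on {0..} (\<lambda>t. modify G X t \<omega>)" for \<omega>
      using good[of \<omega>] by (cases "\<omega> \<in> G") (auto simp: modify_def)
    show "modify G X 0 \<omega> = 0" for \<omega> using good[of \<omega>] by (simp add: modify_def)
    show "((\<lambda>s. modify G X s \<omega>) has_real_derivative - heat_conv' (\<lambda>y. modify G B y \<omega>) t (modify G X t \<omega>)) (at t)"
      if t: "0 < t" for \<omega> t
    proof (cases "\<omega> \<in> G")
      case True
      then show ?thesis using good[OF True] t velocity_eq_heat_conv[of B \<omega> t "X t \<omega>"] by (auto simp: modify_def)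
    next
      case False
      then show ?thesis by (simp add: modify_def heat_conv'_def)
    qed
  qed
  have law_X: "has_law M ucc_topology (\<lambda>\<omega>. \<lambda>\<theta>\<in>{0..}. X (\<theta> * T) \<omega> / T powr (3/4)) (distr M (borel_of ucc_topology) (D.scaled_path T))"
    if "0 < T" for T
    unfolding has_law_def
  proof (intro bexI[OF _ D.scaled_path_measurable[OF that]] conjI refl)
    show "AE \<omega> in M. (\<lambda>\<theta>\<in>{0..}. X (\<theta> * T) \<omega> / T powr (3/4)) = D.scaled_path T \<omega>"
      using G(2) by eventually_elim (simp add: D.scaled_path_def modify_def)
  qed
  have law_Z: "has_law M ucc_topology (\<lambda>\<omega>. \<lambda>\<theta>\<in>{0..}. LINT s:{0..\<theta>}|lborel. velocity B s 0 \<omega>)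
      (distr M (borel_of ucc_topology) (\<lambda>\<omega>. vel_path (\<lambda>y. modify G B y \<omega>)))"
    unfolding has_law_def
  proof (intro bexI[OF _ D.vel_path_measurable] conjI refl)
    show "AE \<omega> in M. (\<lambda>\<theta>\<in>{0..}. LINT s:{0..\<theta>}|lborel. velocity B s 0 \<omega>) = vel_path (\<lambda>y. modify G B y \<omega>)"
      using G(2)
    proof eventually_elim
      case (elim \<omega>)
      then show ?case using good[OF elim] by (simp add: modify_def vel_path_eq_velocity)
    qed
  qed
  have pos: "\<forall>\<^sub>F T::real in at_right 0. 0 < T" by (rule eventually_at_right_less)
  have "weak_convergence ucc_topology (\<lambda>T. distr M (borel_of ucc_topology) (D.scaled_path T))
      (distr M (borel_of ucc_topology) (\<lambda>\<omega>. vel_path (\<lambda>y. modify G B y \<omega>))) (at_right 0)"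
  proof (rule weak_convergence_uccI[OF _ D.vel_path_measurable D.expectation_lipschitz_tendsto])
    show "\<forall>\<^sub>F T in at_right 0. D.scaled_path T \<in> M \<rightarrow>\<^sub>M borel_of ucc_topology"
      using pos by eventually_elim (rule D.scaled_path_measurable)
  qed
  moreover have "\<forall>\<^sub>F T in at_right 0. has_law M ucc_topology (\<lambda>\<omega>. \<lambda>\<theta>\<in>{0..}. X (\<theta> * T) \<omega> / T powr (3/4))
      (distr M (borel_of ucc_topology) (D.scaled_path T))"
    using pos by eventually_elim (rule law_X)
  ultimately show ?thesis
    unfolding converges_in_law_def using law_Z by (intro exI conjI)
qed

end
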